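(* Let $\mathfrak{g}$ be the insertion-elimination Lie algebra over $\mathbb{C}$. If $V \in \mathcal{O}$ is an irreducible representation of $\mathfrak{g}$, then $V$ is a quotient of a Verma module, i.e. there exist $\lambda \in \mathbb{C}$ and a surjective homomorphism of $\mathfrak{g}$-modules $W(\lambda) \to V$.
   Context: A rooted tree is a finite non-empty tree $t$ with a distinguished vertex (its root); rooted trees are considered up to isomorphism, and $\mathbb{T}$ denotes the set of isomorphism classes. $V(t)$ and $E(t)$ are the sets of vertices and edges of $t$, and $|t| = \#V(t)$. For $e \in E(t)$, removing $e$ from $t$ leaves two components: $R_e(t)$, the one containing the root of $t$, with the same root as $t$; and $P_e(t)$, the other one, rooted at the endpoint of $e$ it contains. For $s,t \in \mathbb{T}$ and $v \in V(s)$, $s \cup_v t$ is the rooted tree obtained by joining the root of $t$ to the vertex $v$ of $s$ by a single new edge, with root that of $s$. Equalities of trees below mean isomorphism of rooted trees. The insertion-elimination Lie algebra $\mathfrak{g}$ is the complex Lie algebra with vector space basis $\{D^+_t\}_{t\in\mathbb{T}} \cup \{D^-_t\}_{t \in \mathbb{T}} \cup \{d\}$ and brackets $$[D^+_{t_1}, D^+_{t_2}] = \sum_{v \in V(t_2)} D^+_{t_2 \cup_v t_1} - \sum_{v \in V(t_1)} D^+_{t_1 \cup_v t_2},$$ $$[D^-_{t_1}, D^-_{t_2}] = \sum_{t \in \mathbb{T}} \big(m(t_1,t_2;t) - m(t_2,t_1;t)\big) D^-_t,$$ $$[D^-_{t_1}, D^+_{t_2}] = \sum_{t\in\mathbb{T}}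 \alpha(t_1,t_2;t) D^+_t + \sum_{t \in \mathbb{T}} \beta(t_1,t_2;t) D^-_t \quad (t_1 \neq t_2),$$ $$[D^-_t, D^+_t] = d, \qquad [d, D^-_t] = -|t|\, D^-_t, \qquad [d, D^+_t] = |t|\, D^+_t,$$ where $m(t_1,t_2;t) = \#\{e \in E(t) : R_e(t) = t_1,\ P_e(t) = t_2\}$, $\alpha(t_1,t_2;t) = \#\{e \in E(t_2) : R_e(t_2) = t,\ P_e(t_2) = t_1\}$ and $\beta(t_1,t_2;t) = \#\{v \in V(t) : t \cup_v t_2 = t_1\}$. Equivalently, $\mathfrak{g}$ is the Lie algebra of linear operators, under the commutator, on the complex vector space with basis $\mathbb{T}$ spanned by the operators $D^+_t(s) = \sum_{v \in V(s)} s \cup_v t$, $D^-_t(s) = \sum_{e \in E(s),\, P_e(s) = t} R_e(s)$ and $d(s) = |s|\,s$. Let $\mathfrak{n}_{\pm}$ be the Lie subalgebra spanned by $\{D^{\pm}_t\}_{t \in \mathbb{T}}$, so $\mathfrak{g} = \mathfrak{n}_+ \oplus \mathbb{C} d \oplus \mathfrak{n}_-$. The category $\mathcal{O}$ consists of the lowest-weight representations of $\mathfrak{g}$: complex representations $V$ such that (1) $V = \bigoplus_\delta V_\delta$ is a direct sum of finite-dimensional eigenspaces for $d$ ($d$ acting on $V_\delta$ by $\delta \in \mathbb{C}$), and (2) there exists $L \in \mathbb{R}$ such that $\mathrm{Re}(\delta) \geq L$ for all eigenvalues $\delta$. For $\lambda \in \mathbb{C}$, let $\mathbb{C}_\lambda$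 be the one-dimensional representation of the Lie subalgebra $\mathbb{C} d \oplus \mathfrak{n}_-$ on which $\mathfrak{n}_-$ acts by zero and $d$ acts by multiplication by $\lambda$. The Verma module of lowest weight $\lambda$ is the $\mathfrak{g}$-module $W(\lambda) = U(\mathfrak{g}) \otimes_{U(\mathbb{C} d \oplus \mathfrak{n}_-)} \mathbb{C}_\lambda$, where $U(\cdot)$ denotes the universal enveloping algebra. *)

theory Defs
  imports Complex_Main "HOL-Library.Groups_Big_Fun" "HOL-Algebra.Module" "HOL-Algebra.QuotRing"
    "HOL-Algebra.Free_Abelian_Groups"
begin

section \<open>Rooted trees\<close>

record 'a rgraph =
  verts :: "'a set"
  edges :: "'a set set"
  root :: 'a

definition reach :: "'a set set \<Rightarrow> ('a \<times> 'a) set" where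
  "reach E = {(u, v). {u, v} \<in> E}\<^sup>*"

definition has_cycle :: "'a set set \<Rightarrow> bool" where
  "has_cycle E \<longleftrightarrow> (\<exists>vs. length vs \<ge> 3 \<and> distinct vs \<and>
     (\<forall>i < length vs. {vs ! i, vs ! (Suc i mod length vs)} \<in> E))"

definition rooted_tree :: "'a rgraph \<Rightarrow> bool" where
  "rooted_tree G \<longleftrightarrow> finite (verts G) \<and> root G \<in> verts G \<and>
     (\<forall>e \<in> edges G. e \<subseteq> verts G \<and> card e = 2) \<and>
     (\<forall>u \<in> verts G. \<forall>v \<in> verts G. (u, v) \<in> reach (edges G)) \<and>
     \<not> has_cycle (edges G)"

definition rgraph_iso :: "'a rgraph \<Rightarrow> 'b rgraph \<Rightarrow> bool" (infix "\<cong>\<^sub>r" 50) where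
  "G \<cong>\<^sub>r H \<longleftrightarrow> (\<exists>f. bij_betw f (verts G) (verts H) \<and>
     (\<lambda>e. f ` e) ` edges G = edges H \<and> f (root G) = root H)"

text \<open>For an edge \<open>e\<close>, \<open>cut_root G e\<close> and \<open>cut_branch G e\<close> are the components of \<open>G - e\<close>
  containing and not containing the root of \<open>G\<close>.\<close>

definition cut_root :: "'a rgraph \<Rightarrow> 'a set \<Rightarrow> 'a rgraph" where
  "cut_root G e =
     (let C = {v \<in> verts G. (root G, v) \<in> reach (edges G - {e})}
      in \<lparr>verts = C, edges = {e' \<in> edges G - {e}. e' \<subseteq> C}, root = root G\<rparr>)"

definition cut_branch :: "'a rgraph \<Rightarrow> 'a set \<Rightarrow> 'a rgraph" where
  "cut_branch G e =
     (let C = {v \<in> verts G. (root G, v) \<notin> reach (edges G - {e})}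
      in \<lparr>verts = C, edges = {e' \<in> edges G - {e}. e' \<subseteq> C}, root = (THE v. v \<in> e \<inter> C)\<rparr>)"

definition join :: "'a rgraph \<Rightarrow> 'a \<Rightarrow> 'b rgraph \<Rightarrow> ('a + 'b) rgraph" where
  "join s v t =
     \<lparr>verts = verts s <+> verts t,
      edges = (\<lambda>e. Inl ` e) ` edges s \<union> (\<lambda>e. Inr ` e) ` edges t \<union> {{Inl v, Inr (root t)}},
      root = Inl (root s)\<rparr>"

lemma rgraph_iso_sym:
  assumes "\<forall>e \<in> edges G. e \<subseteq> verts G" "G \<cong>\<^sub>r H" "root G \<in> verts G"
  shows "H \<cong>\<^sub>r G"
proof -
  obtain f where f: "bij_betw f (verts G) (verts H)" "(\<lambda>e. f ` e) ` edges G = edges H"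
    "f (root G) = root H" using assms(2) unfolding rgraph_iso_def by blast
  let ?g = "inv_into (verts G) f"
  have inj: "inj_on f (verts G)" using f(1) by (simp add: bij_betw_def)
  have "(\<lambda>e. ?g ` e) ` edges H = (\<lambda>e. ?g ` f ` e) ` edges G"
    by (simp add: f(2)[symmetric] image_image)
  also have "\<dots> = (\<lambda>e. e) ` edges G"
    using assms(1) inv_into_image_cancel[OF inj] by (intro image_cong[OF refl]) blast
  finally have "(\<lambda>e. ?g ` e) ` edges H = edges G" by simp
  moreover have "?g (root H) = root G"
    using inv_into_f_f[OF inj assms(3)] by (simp add: f(3))
  ultimately show ?thesis unfolding rgraph_iso_def
    using bij_betw_inv_into[OF f(1)] by blast
qed

lemma rgraph_iso_trans:
  assumes "G \<cong>\<^sub>r H" "H \<cong>\<^sub>r K"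
  shows "G \<cong>\<^sub>r K"
proof -
  obtain f where f: "bij_betw f (verts G) (verts H)" "(\<lambda>e. f ` e) ` edges G = edges H"
      "f (root G) = root H"
    using assms(1) unfolding rgraph_iso_def by blast
  obtain g where g: "bij_betw g (verts H) (verts K)" "(\<lambda>e. g ` e) ` edges H = edges K"
      "g (root H) = root K"
    using assms(2) unfolding rgraph_iso_def by blast
  have "(\<lambda>e. (g \<circ> f) ` e) ` edges G = edges K"
    unfolding g(2)[symmetric] f(2)[symmetric] by (simp add: image_image)
  then show ?thesis unfolding rgraph_iso_def
    using bij_betw_trans[OF f(1) g(1)] f(3) g(3) by (intro exI[of _ "g \<circ> f"]) simp
qed

quotient_type rtree = "nat rgraph" / partial:
  "\<lambda>s t. rooted_tree s \<and> rooted_tree t \<and> s \<cong>\<^sub>r t"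
proof (rule part_equivpI)
  have "\<not> has_cycle ({} :: nat set set)"
    unfolding has_cycle_def by (auto intro!: exI[of _ 0])
  then have "rooted_tree \<lparr>verts = {0::nat}, edges = {}, root = 0\<rparr>"
    by (simp add: rooted_tree_def reach_def)
  moreover have "\<lparr>verts = {0::nat}, edges = {}, root = 0\<rparr> \<cong>\<^sub>r \<lparr>verts = {0::nat}, edges = {}, root = 0\<rparr>"
    unfolding rgraph_iso_def by (intro exI[of _ id]) simp
  ultimately show "\<exists>s::nat rgraph. rooted_tree s \<and> rooted_tree s \<and> s \<cong>\<^sub>r s" by blast
next
  show "symp (\<lambda>s t :: nat rgraph. rooted_tree s \<and> rooted_tree t \<and> s \<cong>\<^sub>r t)"
  proof (rule sympI)
    fix s t :: "nat rgraph"
    assume st: "rooted_tree s \<and> rooted_tree t \<and> s \<cong>\<^sub>r t"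
    then have "\<forall>e \<in> edges s. e \<subseteq> verts s" "root s \<in> verts s"
      unfolding rooted_tree_def by blast+
    with st show "rooted_tree t \<and> rooted_tree s \<and> t \<cong>\<^sub>r s"
      using rgraph_iso_sym by blast
  qed
next
  show "transp (\<lambda>s t :: nat rgraph. rooted_tree s \<and> rooted_tree t \<and> s \<cong>\<^sub>r t)"
    by (rule transpI) (blast intro: rgraph_iso_trans)
qed

text \<open>The isomorphism class of a rooted tree with vertices in an arbitrary type.\<close>

definition rtree_of :: "'a rgraph \<Rightarrow> rtree" where
  "rtree_of G = (THE t. G \<cong>\<^sub>r rep_rtree t)"

definition V\<^sub>t :: "rtree \<Rightarrow> nat set" where
  "V\<^sub>t t = verts (rep_rtree t)"

definition E\<^sub>t :: "rtree \<Rightarrow> nat set set" where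
  "E\<^sub>t t = edges (rep_rtree t)"

definition R\<^sub>t :: "nat set \<Rightarrow> rtree \<Rightarrow> rtree" where
  "R\<^sub>t e t = rtree_of (cut_root (rep_rtree t) e)"

definition P\<^sub>t :: "nat set \<Rightarrow> rtree \<Rightarrow> rtree" where
  "P\<^sub>t e t = rtree_of (cut_branch (rep_rtree t) e)"

definition graft :: "rtree \<Rightarrow> nat \<Rightarrow> rtree \<Rightarrow> rtree" where
  "graft s v t = rtree_of (join (rep_rtree s) v (rep_rtree t))"


section \<open>The insertion-elimination Lie algebra\<close>

definition m_coeff :: "rtree \<Rightarrow> rtree \<Rightarrow> rtree \<Rightarrow> nat" where
  "m_coeff t1 t2 t = card {e \<in> E\<^sub>t t. R\<^sub>t e t = t1 \<and> P\<^sub>t e t = t2}"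

definition alpha_coeff :: "rtree \<Rightarrow> rtree \<Rightarrow> rtree \<Rightarrow> nat" where
  "alpha_coeff t1 t2 t = card {e \<in> E\<^sub>t t2. R\<^sub>t e t2 = t \<and> P\<^sub>t e t2 = t1}"

definition beta_coeff :: "rtree \<Rightarrow> rtree \<Rightarrow> rtree \<Rightarrow> nat" where
  "beta_coeff t1 t2 t = card {v \<in> V\<^sub>t t. graft t v t2 = t1}"

text \<open>For fixed \<open>t1\<close>, \<open>t2\<close> each coefficient is nonzero for finitely many \<open>t\<close> only, because the number
  of vertices of \<open>t\<close> is then determined; \<open>Sum_any\<close> below therefore really is the sum over all trees.\<close>

datatype ie_gen = DPlus rtree | DMinus rtree | DGrade

type_synonym ie = "ie_gen \<Rightarrow>\<^sub>0 complex"

abbreviation gen :: "complex \<Rightarrow> ie_gen \<Rightarrow> ie" where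
  "gen c a \<equiv> Poly_Mapping.single a c"

definition minus_plus :: "rtree \<Rightarrow> rtree \<Rightarrow> ie" where
  "minus_plus t1 t2 =
     (if t1 = t2 then gen 1 DGrade
      else Sum_any (\<lambda>t. gen (of_nat (alpha_coeff t1 t2 t)) (DPlus t))
         + Sum_any (\<lambda>t. gen (of_nat (beta_coeff t1 t2 t)) (DMinus t)))"

fun gen_bracket :: "ie_gen \<Rightarrow> ie_gen \<Rightarrow> ie" where
  "gen_bracket (DPlus t1) (DPlus t2) =
     (\<Sum>v \<in> V\<^sub>t t2. gen 1 (DPlus (graft t2 v t1))) - (\<Sum>v \<in> V\<^sub>t t1. gen 1 (DPlus (graft t1 v t2)))"
| "gen_bracket (DMinus t1) (DMinus t2) =
     Sum_any (\<lambda>t. gen (of_nat (m_coeff t1 t2 t) - of_nat (m_coeff t2 t1 t)) (DMinus t))"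
| "gen_bracket (DMinus t1) (DPlus t2) = minus_plus t1 t2"
| "gen_bracket (DPlus t1) (DMinus t2) = - minus_plus t2 t1"
| "gen_bracket DGrade (DMinus t) = gen (- of_nat (card (V\<^sub>t t))) (DMinus t)"
| "gen_bracket (DMinus t) DGrade = gen (of_nat (card (V\<^sub>t t))) (DMinus t)"
| "gen_bracket DGrade (DPlus t) = gen (of_nat (card (V\<^sub>t t))) (DPlus t)"
| "gen_bracket (DPlus t) DGrade = gen (- of_nat (card (V\<^sub>t t))) (DPlus t)"
| "gen_bracket DGrade DGrade = 0"

definition pm_scale :: "complex \<Rightarrow> ('a \<Rightarrow>\<^sub>0 complex) \<Rightarrow> ('a \<Rightarrow>\<^sub>0 complex)" where
  "pm_scale c p = Poly_Mapping.map ((*) c) p"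

definition ie_bracket :: "ie \<Rightarrow> ie \<Rightarrow> ie" where
  "ie_bracket x y = (\<Sum>a \<in> Poly_Mapping.keys x. \<Sum>b \<in> Poly_Mapping.keys y.
     pm_scale (Poly_Mapping.lookup x a * Poly_Mapping.lookup y b) (gen_bracket a b))"

text \<open>As with the records of HOL-Algebra, the fields \<open>mult\<close> and \<open>one\<close> that \<open>module\<close> inherits
  from \<open>ring\<close> carry no meaning for vector spaces and Lie algebras.\<close>

record 'a lie_algebra = "(complex, 'a) module" +
  lie_bracket :: "'a \<Rightarrow> 'a \<Rightarrow> 'a"

definition ie_algebra :: "ie lie_algebra" where
  "ie_algebra = \<lparr>carrier = UNIV, monoid.mult = undefined, one = undefined, ring.zero = 0, add = (+),
     smult = pm_scale, lie_bracket = ie_bracket\<rparr>"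

text \<open>The Lie subalgebra spanned by the grading element and the elimination operators.\<close>

definition ie_lower :: "ie lie_algebra" where
  "ie_lower = ie_algebra\<lparr>carrier := {x. Poly_Mapping.keys x \<subseteq> insert DGrade (Set.range DMinus)}\<rparr>"


section \<open>Representations and the category O\<close>

definition complex_ring :: "complex ring" where
  "complex_ring = \<lparr>carrier = UNIV, monoid.mult = (*), one = 1, ring.zero = 0, add = (+)\<rparr>"

locale lie_rep = module complex_ring V
  for L :: "('l, 'm) lie_algebra_scheme" and V :: "(complex, 'v, 'n) module_scheme" (structure) +
  fixes \<rho> :: "'l \<Rightarrow> 'v \<Rightarrow> 'v"
  assumes act_closed: "\<lbrakk>x \<in> carrier L; v \<in> carrier V\<rbrakk> \<Longrightarrow> \<rho> x v \<in> carrier V"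
    and act_add: "\<lbrakk>x \<in> carrier L; v \<in> carrier V; w \<in> carrier V\<rbrakk> \<Longrightarrow> \<rho> x (v \<oplus> w) = \<rho> x v \<oplus> \<rho> x w"
    and act_smult: "\<lbrakk>x \<in> carrier L; v \<in> carrier V\<rbrakk> \<Longrightarrow> \<rho> x (c \<odot> v) = c \<odot> \<rho> x v"
    and add_act: "\<lbrakk>x \<in> carrier L; y \<in> carrier L; v \<in> carrier V\<rbrakk> \<Longrightarrow>
          \<rho> (x \<oplus>\<^bsub>L\<^esub> y) v = \<rho> x v \<oplus> \<rho> y v"
    and smult_act: "\<lbrakk>x \<in> carrier L; v \<in> carrier V\<rbrakk> \<Longrightarrow> \<rho> (c \<odot>\<^bsub>L\<^esub> x) v = c \<odot> \<rho> x v"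
    and bracket_act: "\<lbrakk>x \<in> carrier L; y \<in> carrier L; v \<in> carrier V\<rbrakk> \<Longrightarrow>
          \<rho> (lie_bracket L x y) v = \<rho> x (\<rho> y v) \<ominus> \<rho> y (\<rho> x v)"

definition subrep ::
  "('l, 'm) lie_algebra_scheme \<Rightarrow> (complex, 'v, 'n) module_scheme \<Rightarrow> ('l \<Rightarrow> 'v \<Rightarrow> 'v) \<Rightarrow> 'v set \<Rightarrow> bool" where
  "subrep L V \<rho> U \<longleftrightarrow> submodule U complex_ring V \<and> (\<forall>x \<in> carrier L. \<forall>u \<in> U. \<rho> x u \<in> U)"

definition irreducible_rep ::
  "('l, 'm) lie_algebra_scheme \<Rightarrow> (complex, 'v, 'n) module_scheme \<Rightarrow> ('l \<Rightarrow> 'v \<Rightarrow> 'v) \<Rightarrow> bool" where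
  "irreducible_rep L V \<rho> \<longleftrightarrow> lie_rep L V \<rho> \<and> carrier V \<noteq> {\<zero>\<^bsub>V\<^esub>} \<and>
     (\<forall>U. subrep L V \<rho> U \<longrightarrow> U = {\<zero>\<^bsub>V\<^esub>} \<or> U = carrier V)"

definition rep_hom ::
  "('l, 'm) lie_algebra_scheme \<Rightarrow> (complex, 'v, 'n) module_scheme \<Rightarrow> ('l \<Rightarrow> 'v \<Rightarrow> 'v) \<Rightarrow>
   (complex, 'w, 'k) module_scheme \<Rightarrow> ('l \<Rightarrow> 'w \<Rightarrow> 'w) \<Rightarrow> ('v \<Rightarrow> 'w) set" where
  "rep_hom L V \<rho> W \<sigma> = {f \<in> carrier V \<rightarrow> carrier W.
     (\<forall>v \<in> carrier V. \<forall>w \<in> carrier V. f (v \<oplus>\<^bsub>V\<^esub> w) = f v \<oplus>\<^bsub>W\<^esub> f w) \<and>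
     (\<forall>c. \<forall>v \<in> carrier V. f (c \<odot>\<^bsub>V\<^esub> v) = c \<odot>\<^bsub>W\<^esub> f v) \<and>
     (\<forall>x \<in> carrier L. \<forall>v \<in> carrier V. f (\<rho> x v) = \<sigma> x (f v))}"

definition finite_dim :: "(complex, 'v, 'n) module_scheme \<Rightarrow> 'v set \<Rightarrow> bool" where
  "finite_dim V E \<longleftrightarrow> (\<exists>B. finite B \<and> B \<subseteq> E \<and>
     (\<forall>v \<in> E. \<exists>c. v = (\<Oplus>\<^bsub>V\<^esub>b \<in> B. c b \<odot>\<^bsub>V\<^esub> b)))"

definition direct_sum_decomp :: "(complex, 'v, 'n) module_scheme \<Rightarrow> ('i \<Rightarrow> 'v set) \<Rightarrow> bool" where
  "direct_sum_decomp V E \<longleftrightarrow> (\<forall>i. submodule (E i) complex_ring V) \<and>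
     (\<forall>v \<in> carrier V. \<exists>!f. (\<forall>i. f i \<in> E i) \<and> finite {i. f i \<noteq> \<zero>\<^bsub>V\<^esub>} \<and>
        v = (\<Oplus>\<^bsub>V\<^esub>i \<in> {i. f i \<noteq> \<zero>\<^bsub>V\<^esub>}. f i))"

definition d_eigenspace :: "(complex, 'v, 'n) module_scheme \<Rightarrow> (ie \<Rightarrow> 'v \<Rightarrow> 'v) \<Rightarrow> complex \<Rightarrow> 'v set" where
  "d_eigenspace V \<rho> \<delta> = {v \<in> carrier V. \<rho> (gen 1 DGrade) v = \<delta> \<odot>\<^bsub>V\<^esub> v}"

definition category_O :: "(complex, 'v, 'n) module_scheme \<Rightarrow> (ie \<Rightarrow> 'v \<Rightarrow> 'v) \<Rightarrow> bool" where
  "category_O V \<rho> \<longleftrightarrow> lie_rep ie_algebra V \<rho> \<and>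
     direct_sum_decomp V (d_eigenspace V \<rho>) \<and>
     (\<forall>\<delta>. finite_dim V (d_eigenspace V \<rho> \<delta>)) \<and>
     (\<exists>l::real. \<forall>\<delta>. d_eigenspace V \<rho> \<delta> \<noteq> {\<zero>\<^bsub>V\<^esub>} \<longrightarrow> Re \<delta> \<ge> l)"


section \<open>Universal enveloping algebras\<close>

text \<open>Words form the free monoid, written additively so that \<open>'a fword \<Rightarrow>\<^sub>0 complex\<close> with the
  convolution product of \<open>Poly_Mapping\<close> is the free associative unital algebra.\<close>

datatype 'a fword = Word (letters: "'a list")

instantiation fword :: (type) monoid_add
begin

definition zero_fword :: "'a fword" where
  "0 = Word []"

definition plus_fword :: "'a fword \<Rightarrow> 'a fword \<Rightarrow> 'a fword" where
  "u + w = Word (letters u @ letters w)"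

instance
  by standard (simp_all add: zero_fword_def plus_fword_def)

end

type_synonym 'a falg = "'a fword \<Rightarrow>\<^sub>0 complex"

definition free_algebra :: "'a set \<Rightarrow> 'a falg ring" where
  "free_algebra S = \<lparr>carrier = {p. \<forall>w \<in> Poly_Mapping.keys p. set (letters w) \<subseteq> S},
     monoid.mult = (*), one = 1, ring.zero = 0, add = (+)\<rparr>"

definition letter :: "'a \<Rightarrow> 'a falg" where
  "letter x = Poly_Mapping.single (Word [x]) 1"

text \<open>The enveloping algebra is presented with all elements of \<open>L\<close> as generators. The first two
  families of relations turn the free algebra on the set \<open>L\<close> into the tensor algebra of the
  vector space \<open>L\<close>.\<close>

definition uea_relations :: "('l, 'm) lie_algebra_scheme \<Rightarrow> 'l falg set" where
  "uea_relations L =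
     {letter (x \<oplus>\<^bsub>L\<^esub> y) - (letter x + letter y) | x y. x \<in> carrier L \<and> y \<in> carrier L} \<union>
     {letter (c \<odot>\<^bsub>L\<^esub> x) - pm_scale c (letter x) | c x. x \<in> carrier L} \<union>
     {letter x * letter y - letter y * letter x - letter (lie_bracket L x y) | x y.
        x \<in> carrier L \<and> y \<in> carrier L}"

definition uea_ideal :: "('l, 'm) lie_algebra_scheme \<Rightarrow> 'l falg set" where
  "uea_ideal L = genideal (free_algebra (carrier L)) (uea_relations L)"

definition uea :: "('l, 'm) lie_algebra_scheme \<Rightarrow> 'l falg set ring" where
  "uea L = free_algebra (carrier L) Quot uea_ideal L"

definition uea_class :: "('l, 'm) lie_algebra_scheme \<Rightarrow> 'l falg \<Rightarrow> 'l falg set" where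
  "uea_class L p = uea_ideal L +>\<^bsub>free_algebra (carrier L)\<^esub> p"

text \<open>The homomorphism \<open>U(K) \<rightarrow> U(L)\<close> induced by the inclusion of a Lie subalgebra \<open>K\<close> of \<open>L\<close>.
  The ideal of \<open>K\<close> is contained in that of \<open>L\<close>, so the coset of \<open>p\<close> is sent to the coset of \<open>p\<close>.\<close>

definition uea_incl :: "('l, 'm) lie_algebra_scheme \<Rightarrow> 'l falg set \<Rightarrow> 'l falg set" where
  "uea_incl L A = uea_ideal L <+>\<^bsub>free_algebra (carrier L)\<^esub> A"

definition free_act ::
  "(complex, 'v, 'n) module_scheme \<Rightarrow> ('l \<Rightarrow> 'v \<Rightarrow> 'v) \<Rightarrow> 'l falg \<Rightarrow> 'v \<Rightarrow> 'v" where
  "free_act V \<rho> p v = (\<Oplus>\<^bsub>V\<^esub>w \<in> Poly_Mapping.keys p.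
     Poly_Mapping.lookup p w \<odot>\<^bsub>V\<^esub> foldr \<rho> (letters w) v)"

text \<open>A representation is a module over the enveloping algebra: all members of a coset act
  in the same way, so the set below is a singleton.\<close>

definition uea_act ::
  "(complex, 'v, 'n) module_scheme \<Rightarrow> ('l \<Rightarrow> 'v \<Rightarrow> 'v) \<Rightarrow> 'l falg set \<Rightarrow> 'v \<Rightarrow> 'v" where
  "uea_act V \<rho> A v = the_elem ((\<lambda>p. free_act V \<rho> p v) ` A)"


section \<open>Tensor products and Verma modules\<close>

text \<open>The tensor product of a right \<open>R\<close>-module \<open>M\<close> and a left \<open>R\<close>-module \<open>N\<close> over a ring \<open>R\<close> that
  need not be commutative. Of the first arguments only carrier and addition matter; the
  two \<open>R\<close>-actions are \<open>r\<close> and \<open>l\<close>. The result is an abelian group in multiplicative notation.\<close>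

definition tensor_relations ::
  "('r, 'a) ring_scheme \<Rightarrow> ('m, 'b) ring_scheme \<Rightarrow> ('m \<Rightarrow> 'r \<Rightarrow> 'm) \<Rightarrow>
   ('n, 'c) ring_scheme \<Rightarrow> ('r \<Rightarrow> 'n \<Rightarrow> 'n) \<Rightarrow> ('m \<times> 'n \<Rightarrow>\<^sub>0 int) set" where
  "tensor_relations R M r N l =
     {frag_of (x \<oplus>\<^bsub>M\<^esub> x', y) - (frag_of (x, y) + frag_of (x', y)) | x x' y.
        x \<in> carrier M \<and> x' \<in> carrier M \<and> y \<in> carrier N} \<union>
     {frag_of (x, y \<oplus>\<^bsub>N\<^esub> y') - (frag_of (x, y) + frag_of (x, y')) | x y y'.
        x \<in> carrier M \<and> y \<in> carrier N \<and> y' \<in> carrier N} \<union>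
     {frag_of (r x a, y) - frag_of (x, l a y) | x a y.
        x \<in> carrier M \<and> a \<in> carrier R \<and> y \<in> carrier N}"

definition tensor_product ::
  "('r, 'a) ring_scheme \<Rightarrow> ('m, 'b) ring_scheme \<Rightarrow> ('m \<Rightarrow> 'r \<Rightarrow> 'm) \<Rightarrow>
   ('n, 'c) ring_scheme \<Rightarrow> ('r \<Rightarrow> 'n \<Rightarrow> 'n) \<Rightarrow> ('m \<times> 'n \<Rightarrow>\<^sub>0 int) set monoid" where
  "tensor_product R M r N l =
     free_Abelian_group (carrier M \<times> carrier N) Mod
     generate (free_Abelian_group (carrier M \<times> carrier N)) (tensor_relations R M r N l)"

text \<open>The endomorphism \<open>x \<otimes> y \<mapsto> h x \<otimes> y\<close> of a tensor product \<open>T\<close>, for \<open>h\<close> an endomorphism of the right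
  module. The relation subgroup \<open>\<one>\<^bsub>T\<^esub>\<close> is added to the image of a coset to complete it to a coset.\<close>

definition tensor_map_left ::
  "('m, 'b) ring_scheme \<Rightarrow> ('n, 'c) ring_scheme \<Rightarrow> ('m \<times> 'n \<Rightarrow>\<^sub>0 int) set monoid \<Rightarrow>
   ('m \<Rightarrow> 'm) \<Rightarrow> ('m \<times> 'n \<Rightarrow>\<^sub>0 int) set \<Rightarrow> ('m \<times> 'n \<Rightarrow>\<^sub>0 int) set" where
  "tensor_map_left M N T h A =
     \<one>\<^bsub>T\<^esub> <#>\<^bsub>free_Abelian_group (carrier M \<times> carrier N)\<^esub>
     frag_extend (\<lambda>(x, y). frag_of (h x, y)) ` A"

definition complex_line :: "(complex, complex) module" where
  "complex_line = \<lparr>carrier = UNIV, monoid.mult = (*), one = 1, ring.zero = 0, add = (+), smult = (*)\<rparr>"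

definition weight_act :: "complex \<Rightarrow> ie \<Rightarrow> complex \<Rightarrow> complex" where
  "weight_act lam x z = Poly_Mapping.lookup x DGrade * lam * z"

type_synonym verma_vec = "(ie falg set \<times> complex \<Rightarrow>\<^sub>0 int) set"

definition verma_tensor :: "complex \<Rightarrow> verma_vec monoid" where
  "verma_tensor lam = tensor_product (uea ie_lower)
     (uea ie_algebra) (\<lambda>u a. u \<otimes>\<^bsub>uea ie_algebra\<^esub> uea_incl ie_algebra a)
     complex_line (uea_act complex_line (weight_act lam))"

definition verma_uea_act :: "complex \<Rightarrow> ie falg set \<Rightarrow> verma_vec \<Rightarrow> verma_vec" where
  "verma_uea_act lam u = tensor_map_left (uea ie_algebra) complex_line (verma_tensor lam)
     (\<lambda>x. u \<otimes>\<^bsub>uea ie_algebra\<^esub> x)"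

definition verma :: "complex \<Rightarrow> (complex, verma_vec) module" where
  "verma lam = \<lparr>carrier = carrier (verma_tensor lam), monoid.mult = undefined, one = undefined,
     ring.zero = \<one>\<^bsub>verma_tensor lam\<^esub>, add = monoid.mult (verma_tensor lam),
     smult = (\<lambda>c. verma_uea_act lam (uea_class ie_algebra (Poly_Mapping.single 0 c)))\<rparr>"

definition verma_act :: "complex \<Rightarrow> ie \<Rightarrow> verma_vec \<Rightarrow> verma_vec" where
  "verma_act lam x = verma_uea_act lam (uea_class ie_algebra (letter x))"

end

theory Submission
  imports Defs
begin

text \<open>
The proof is the standard one for highest-weight categories. The real parts of the weights of a
representation in category O are bounded below, and each \<open>D\<^sup>-\<^sub>t\<close> lowers the weight by the positive
integer \<open>|t|\<close>. A nonzero representation in O therefore has a nonzero weight vector \<open>v\<close>, of some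
weight \<open>\<lambda>\<close>, annihilated by all of \<open>\<nn>\<^sub>-\<close> (lemma \<open>category_O_lowest_weight_vector\<close>). The Verma module being
induced from the one-dimensional representation of weight \<open>\<lambda>\<close>, such a vector gives a homomorphism from
\<open>W(\<lambda>)\<close> whose image contains \<open>v\<close> (lemma \<open>verma_universal\<close>). The image is a nonzero subrepresentation, so
it is everything when the representation is irreducible.

Most of the work is the universal property, since both the enveloping algebra and the tensor product
are given by generators and relations. A representation is first made a module over the free
associative algebra; the relations of the enveloping algebra act by zero
(lemma \<open>free_act_uea_ideal\<close>), so cosets act through any representative (lemma \<open>uea_act_class\<close>). Balanced
biadditive maps then factor through the tensor product (lemma \<open>tensor_universal\<close>), and equations between
additive maps on it are checked on elementary tensors (lemma \<open>tensor_map_left_equivariant\<close>).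
\<close>

section \<open>Free associative algebras\<close>

lemma letters_zero [simp]: "letters 0 = []"
  by (simp add: zero_fword_def)

lemma letters_plus [simp]: "letters (u + w) = letters u @ letters w"
  by (simp add: plus_fword_def)

lemma free_algebra_ops [simp]:
  "x \<oplus>\<^bsub>free_algebra S\<^esub> y = x + y" "x \<otimes>\<^bsub>free_algebra S\<^esub> y = x * y"
  "\<zero>\<^bsub>free_algebra S\<^esub> = 0" "\<one>\<^bsub>free_algebra S\<^esub> = 1"
  by (simp_all add: free_algebra_def)

lemma mem_free_algebra:
  "p \<in> carrier (free_algebra S) \<longleftrightarrow> (\<forall>w \<in> Poly_Mapping.keys p. set (letters w) \<subseteq> S)"
  by (simp add: free_algebra_def)

lemma free_algebra_closed:
  shows free_algebra_zero: "0 \<in> carrier (free_algebra S)"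
    and free_algebra_one: "1 \<in> carrier (free_algebra S)"
    and free_algebra_single: "set (letters w) \<subseteq> S \<Longrightarrow> Poly_Mapping.single w c \<in> carrier (free_algebra S)"
    and free_algebra_letter: "x \<in> S \<Longrightarrow> letter x \<in> carrier (free_algebra S)"
    and free_algebra_uminus: "p \<in> carrier (free_algebra S) \<Longrightarrow> - p \<in> carrier (free_algebra S)"
    and free_algebra_add: "p \<in> carrier (free_algebra S) \<Longrightarrow> q \<in> carrier (free_algebra S) \<Longrightarrow>
          p + q \<in> carrier (free_algebra S)"
    and free_algebra_diff: "p \<in> carrier (free_algebra S) \<Longrightarrow> q \<in> carrier (free_algebra S) \<Longrightarrow>
          p - q \<in> carrier (free_algebra S)"
    and free_algebra_mult: "p \<in> carrier (free_algebra S) \<Longrightarrow> q \<in> carrier (free_algebra S) \<Longrightarrow>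
          p * q \<in> carrier (free_algebra S)"
  using keys_add[of p q] keys_diff[of p q] keys_mult[of p q]
  by (fastforce simp: mem_free_algebra letter_def)+

lemma ring_free_algebra: "ring (free_algebra S)"
proof (rule ringI)
  show "abelian_group (free_algebra S)"
  proof (rule abelian_groupI)
    show "\<exists>y\<in>carrier (free_algebra S). y \<oplus>\<^bsub>free_algebra S\<^esub> x = \<zero>\<^bsub>free_algebra S\<^esub>"
      if "x \<in> carrier (free_algebra S)" for x
      using that by (intro bexI[of _ "- x"]) (auto intro: free_algebra_closed)
  qed (auto simp: add_ac intro: free_algebra_closed)
  show "monoid (free_algebra S)"
    by (rule monoidI) (auto simp: mult.assoc intro: free_algebra_closed)
qed (auto simp: distrib_left distrib_right)

text \<open>Finitely supported functions are finite sums of monomials. The support is tracked so that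
the free algebra on a subset of letters, and the lower subalgebra of the Lie algebra, can be
treated by the same induction.\<close>

lemma poly_mapping_induct_keys [consumes 1, case_names zero single add]:
  fixes p :: "'a \<Rightarrow>\<^sub>0 'b::comm_monoid_add"
  assumes "Poly_Mapping.keys p \<subseteq> K"
    and zero: "P 0"
    and single: "\<And>k c. k \<in> K \<Longrightarrow> P (Poly_Mapping.single k c)"
    and add: "\<And>p q. \<lbrakk>Poly_Mapping.keys p \<subseteq> K; Poly_Mapping.keys q \<subseteq> K; P p; P q\<rbrakk> \<Longrightarrow> P (p + q)"
  shows "P p"
proof -
  have keys_partial: "Poly_Mapping.keys (\<Sum>k\<in>F. Poly_Mapping.single k (Poly_Mapping.lookup p k)) \<subseteq> K"
    if "F \<subseteq> K" for F
    using keys_sum[of "\<lambda>k. Poly_Mapping.single k (Poly_Mapping.lookup p k)" F] that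
    by (fastforce split: if_splits)
  have "P (\<Sum>k\<in>F. Poly_Mapping.single k (Poly_Mapping.lookup p k))" if "finite F" "F \<subseteq> K" for F
    using that
  proof (induction F rule: finite_induct)
    case (insert k F)
    then show ?case
      using keys_partial[of F] by (simp add: add single)
  qed (simp add: zero)
  moreover have "p = (\<Sum>k\<in>Poly_Mapping.keys p. Poly_Mapping.single k (Poly_Mapping.lookup p k))"
    by (rule poly_mapping_eqI)
       (auto simp: lookup_sum lookup_single when_def in_keys_iff sum.delta')
  ultimately show ?thesis
    using assms(1) by (metis finite_keys)
qed

lemma free_algebra_induct [consumes 1, case_names single add]:
  assumes "p \<in> carrier (free_algebra S)"
    and single: "\<And>w c. set (letters w) \<subseteq> S \<Longrightarrow> P (Poly_Mapping.single w c)"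
    and add: "\<And>p q. \<lbrakk>p \<in> carrier (free_algebra S); q \<in> carrier (free_algebra S); P p; P q\<rbrakk> \<Longrightarrow> P (p + q)"
  shows "P p"
proof -
  have "Poly_Mapping.keys p \<subseteq> {w. set (letters w) \<subseteq> S}"
    using assms(1) by (auto simp: mem_free_algebra)
  then show ?thesis
  proof (induction p rule: poly_mapping_induct_keys)
    case zero
    show ?case using single[of 0 0] by simp
  next
    case (add p q)
    then show ?case
      using assms(3)[of p q] by (auto simp: mem_free_algebra)
  qed (auto intro: single)
qed

lemma pm_scale_single [simp]: "pm_scale c (Poly_Mapping.single k a) = Poly_Mapping.single k (c * a)"
  by (simp add: pm_scale_def)

lemma lookup_pm_scale [simp]: "Poly_Mapping.lookup (pm_scale c p) k = c * Poly_Mapping.lookup p k"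
  by (simp add: pm_scale_def Poly_Mapping.map.rep_eq when_def)


section \<open>Representations as modules over the free algebra\<close>

lemma complex_ring_simps [simp]:
  "carrier complex_ring = UNIV" "x \<oplus>\<^bsub>complex_ring\<^esub> y = x + y" "x \<otimes>\<^bsub>complex_ring\<^esub> y = x * y"
  "\<zero>\<^bsub>complex_ring\<^esub> = 0" "\<one>\<^bsub>complex_ring\<^esub> = 1"
  by (simp_all add: complex_ring_def)

context lie_rep
begin

abbreviation word_act :: "'l fword \<Rightarrow> 'v \<Rightarrow> 'v" where
  "word_act w \<equiv> foldr \<rho> (letters w)"

lemma scal_closed [simp]: "v \<in> carrier V \<Longrightarrow> c \<odot> v \<in> carrier V"
  using smult_closed by simp

lemma scal_add_left: "v \<in> carrier V \<Longrightarrow> (a + b) \<odot> v = a \<odot> v \<oplus> b \<odot> v"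
  using smult_l_distr by simp

lemma scal_add_right: "v \<in> carrier V \<Longrightarrow> w \<in> carrier V \<Longrightarrow> a \<odot> (v \<oplus> w) = a \<odot> v \<oplus> a \<odot> w"
  using smult_r_distr by simp

lemma scal_scal: "v \<in> carrier V \<Longrightarrow> a \<odot> (b \<odot> v) = (a * b) \<odot> v"
  using smult_assoc1 by simp

lemma scal_one: "v \<in> carrier V \<Longrightarrow> 1 \<odot> v = v"
  using smult_one by simp

lemma scal_zero: "v \<in> carrier V \<Longrightarrow> 0 \<odot> v = \<zero>"
  using smult_l_null by simp

lemma foldr_act_closed:
  "set xs \<subseteq> carrier L \<Longrightarrow> v \<in> carrier V \<Longrightarrow> foldr \<rho> xs v \<in> carrier V"
  by (induction xs) (auto intro: act_closed)

lemma foldr_act_add: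
  "set xs \<subseteq> carrier L \<Longrightarrow> v \<in> carrier V \<Longrightarrow> w \<in> carrier V \<Longrightarrow>
     foldr \<rho> xs (v \<oplus> w) = foldr \<rho> xs v \<oplus> foldr \<rho> xs w"
  by (induction xs) (auto simp: act_add foldr_act_closed)

lemma foldr_act_smult:
  "set xs \<subseteq> carrier L \<Longrightarrow> v \<in> carrier V \<Longrightarrow> foldr \<rho> xs (c \<odot> v) = c \<odot> foldr \<rho> xs v"
  by (induction xs) (auto simp: act_smult foldr_act_closed)

text \<open>Summing over a superset of the support makes the index set common to several elements, which is
what additivity of the action needs.\<close>

lemma free_act_eq_finsum:
  assumes "finite K" "Poly_Mapping.keys p \<subseteq> K" "\<And>w. w \<in> K \<Longrightarrow> set (letters w) \<subseteq> carrier L"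
    and v: "v \<in> carrier V"
  shows "free_act V \<rho> p v = (\<Oplus>w\<in>K. Poly_Mapping.lookup p w \<odot> word_act w v)"
  unfolding free_act_def
proof (rule add.finprod_mono_neutral_cong_left[OF assms(1,2)])
  show "Poly_Mapping.lookup p w \<odot> word_act w v = \<zero>" if "w \<in> K - Poly_Mapping.keys p" for w
    using that assms(3) v by (auto simp: in_keys_iff scal_zero foldr_act_closed)
qed (use assms(3) v in \<open>auto simp: foldr_act_closed\<close>)

lemma free_act_closed [simp]:
  assumes "p \<in> carrier (free_algebra (carrier L))" "v \<in> carrier V"
  shows "free_act V \<rho> p v \<in> carrier V"
  unfolding free_act_def using assms
  by (intro finsum_closed) (auto simp: mem_free_algebra foldr_act_closed)

lemma free_act_single:
  assumes "set (letters w) \<subseteq> carrier L" "v \<in> carrier V"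
  shows "free_act V \<rho> (Poly_Mapping.single w c) v = c \<odot> word_act w v"
  using assms free_act_eq_finsum[of "{w}" "Poly_Mapping.single w c" v] by (simp add: foldr_act_closed)

lemma free_act_letter:
  assumes "x \<in> carrier L" "v \<in> carrier V"
  shows "free_act V \<rho> (letter x) v = \<rho> x v"
  using assms by (simp add: letter_def free_act_single scal_one act_closed)

lemma free_act_scalar:
  "v \<in> carrier V \<Longrightarrow> free_act V \<rho> (Poly_Mapping.single 0 c) v = c \<odot> v"
  by (simp add: free_act_single)

lemma free_act_add:
  assumes p: "p \<in> carrier (free_algebra (carrier L))" and q: "q \<in> carrier (free_algebra (carrier L))"
    and v: "v \<in> carrier V"
  shows "free_act V \<rho> (p + q) v = free_act V \<rho> p v \<oplus> free_act V \<rho> q v"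
proof -
  let ?K = "Poly_Mapping.keys p \<union> Poly_Mapping.keys q"
  have K: "set (letters w) \<subseteq> carrier L" if "w \<in> ?K" for w
    using that p q by (auto simp: mem_free_algebra)
  have "(\<Oplus>w\<in>?K. Poly_Mapping.lookup (p + q) w \<odot> word_act w v)
      = (\<Oplus>w\<in>?K. Poly_Mapping.lookup p w \<odot> word_act w v \<oplus> Poly_Mapping.lookup q w \<odot> word_act w v)"
    using K v by (intro add.finprod_cong') (auto simp: lookup_add scal_add_left foldr_act_closed)
  also have "\<dots> = (\<Oplus>w\<in>?K. Poly_Mapping.lookup p w \<odot> word_act w v)
      \<oplus> (\<Oplus>w\<in>?K. Poly_Mapping.lookup q w \<odot> word_act w v)"
    using K v by (intro add.finprod_multf) (auto simp: foldr_act_closed)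
  finally show ?thesis
    using K v keys_add[of p q] free_act_eq_finsum[of ?K p v] free_act_eq_finsum[of ?K q v]
      free_act_eq_finsum[of ?K "p + q" v] by simp
qed

lemma free_act_diff:
  assumes p: "p \<in> carrier (free_algebra (carrier L))" and q: "q \<in> carrier (free_algebra (carrier L))"
    and v: "v \<in> carrier V"
  shows "free_act V \<rho> (p - q) v = free_act V \<rho> p v \<ominus> free_act V \<rho> q v"
proof -
  have "free_act V \<rho> p v = free_act V \<rho> (p - q) v \<oplus> free_act V \<rho> q v"
    using free_act_add[OF free_algebra_diff[OF p q] q v] by simp
  then show ?thesis
    using p q v by (simp add: minus_eq add.inv_solve_right free_algebra_diff)
qed

lemma free_act_add_vec:
  assumes "p \<in> carrier (free_algebra (carrier L))" "v \<in> carrier V" "w \<in> carrier V"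
  shows "free_act V \<rho> p (v \<oplus> w) = free_act V \<rho> p v \<oplus> free_act V \<rho> p w"
  using assms(1)
proof (induction p rule: free_algebra_induct)
  case (single u c)
  then show ?case
    using assms(2,3) by (simp add: free_act_single foldr_act_add scal_add_right foldr_act_closed)
next
  case (add p q)
  then show ?case
    using assms(2,3) by (simp add: free_act_add a_ac)
qed

lemma free_act_smult_vec:
  assumes "p \<in> carrier (free_algebra (carrier L))" "v \<in> carrier V"
  shows "free_act V \<rho> p (c \<odot> v) = c \<odot> free_act V \<rho> p v"
  using assms(1)
proof (induction p rule: free_algebra_induct)
  case (single u a)
  then show ?case
    using assms(2) by (simp add: free_act_single foldr_act_smult scal_scal foldr_act_closed mult.commute)
next
  case (add p q)
  then show ?case
    using assms(2) by (simp add: free_act_add scal_add_right)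
qed

lemma free_act_mult:
  assumes p: "p \<in> carrier (free_algebra (carrier L))" and q: "q \<in> carrier (free_algebra (carrier L))"
    and v: "v \<in> carrier V"
  shows "free_act V \<rho> (p * q) v = free_act V \<rho> p (free_act V \<rho> q v)"
  using p
proof (induction p rule: free_algebra_induct)
  case (single u a)
  show ?case
    using q
  proof (induction q rule: free_algebra_induct)
    case (single w b)
    then show ?case
      using \<open>set (letters u) \<subseteq> carrier L\<close> v
      by (simp add: mult_single free_act_single foldr_act_smult foldr_act_closed scal_scal)
  next
    case (add p q)
    then show ?case
      using \<open>set (letters u) \<subseteq> carrier L\<close> v
      by (simp add: distrib_left free_act_add free_act_add_vec free_algebra_mult free_algebra_single)
  qed
next
  case (add p p')
  then show ?case
    using q v by (simp add: distrib_right free_act_add free_algebra_mult)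
qed

lemma free_act_zero: "v \<in> carrier V \<Longrightarrow> free_act V \<rho> 0 v = \<zero>"
  by (simp add: free_act_def)

lemma free_act_zero_vec: "p \<in> carrier (free_algebra (carrier L)) \<Longrightarrow> free_act V \<rho> p \<zero> = \<zero>"
  using free_act_smult_vec[of p \<zero> 0] by (simp add: scal_zero)

lemma free_act_one: "v \<in> carrier V \<Longrightarrow> free_act V \<rho> 1 v = v"
  using free_act_scalar[of v 1] by (simp add: scal_one)

text \<open>The kernel of the action of the free algebra. Since it is an ideal, it contains all of
\<^term>\<open>uea_ideal L\<close> as soon as it contains the defining relations.\<close>

lemma ideal_annihilator:
  "ideal {p \<in> carrier (free_algebra (carrier L)). \<forall>v \<in> carrier V. free_act V \<rho> p v = \<zero>}
     (free_algebra (carrier L))" (is "ideal ?A ?F")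
proof (rule idealI[OF ring_free_algebra])
  interpret F: ring ?F by (rule ring_free_algebra)
  show "subgroup ?A (add_monoid ?F)"
  proof (rule F.add.subgroupI)
    show "\<ominus>\<^bsub>?F\<^esub> p \<in> ?A" if "p \<in> ?A" for p
    proof -
      have "\<ominus>\<^bsub>?F\<^esub> p = 0 - p"
        using that by (intro F.minus_equality) (auto intro: free_algebra_closed)
      moreover have "free_act V \<rho> (0 - p) v = \<zero>" if "v \<in> carrier V" for v
        using free_act_diff[of 0 p v] \<open>p \<in> ?A\<close> that
        by (simp add: free_act_zero free_algebra_zero minus_eq)
      ultimately show ?thesis
        using that by (auto intro: free_algebra_uminus)
    qed
  qed (auto simp: free_act_zero free_act_add intro: free_algebra_closed exI[of _ 0])
qed (auto simp: free_act_mult free_act_zero_vec intro: free_algebra_mult)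

end

section \<open>Universal enveloping algebras\<close>

text \<open>Closure under the operations puts the relations of the enveloping algebra inside the free algebra
on \<open>L\<close>, so that they generate an ideal there and the quotient is a ring.\<close>

locale bracket_space =
  fixes L :: "('l, 'm) lie_algebra_scheme" (structure)
  assumes sum_closed: "\<lbrakk>x \<in> carrier L; y \<in> carrier L\<rbrakk> \<Longrightarrow> x \<oplus> y \<in> carrier L"
    and scale_closed: "x \<in> carrier L \<Longrightarrow> c \<odot> x \<in> carrier L"
    and bracket_closed: "\<lbrakk>x \<in> carrier L; y \<in> carrier L\<rbrakk> \<Longrightarrow> lie_bracket L x y \<in> carrier L"
begin

lemma uea_relations_subset: "uea_relations L \<subseteq> carrier (free_algebra (carrier L))"
  unfolding uea_relations_def
  by (auto intro!: free_algebra_diff free_algebra_add free_algebra_mult free_algebra_letter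
      sum_closed scale_closed bracket_closed)
    (auto simp: letter_def intro: free_algebra_single)

lemma ideal_uea_ideal: "ideal (uea_ideal L) (free_algebra (carrier L))"
  unfolding uea_ideal_def
  by (rule ring.genideal_ideal[OF ring_free_algebra uea_relations_subset])

interpretation uea_ideal: ideal "uea_ideal L" "free_algebra (carrier L)"
  by (rule ideal_uea_ideal)

lemma uea_ideal_subset: "uea_ideal L \<subseteq> carrier (free_algebra (carrier L))"
  by (rule uea_ideal.a_subset)

lemma uea_ideal_closed:
  shows uea_ideal_zero: "0 \<in> uea_ideal L"
    and uea_ideal_add: "p \<in> uea_ideal L \<Longrightarrow> q \<in> uea_ideal L \<Longrightarrow> p + q \<in> uea_ideal L"
    and uea_ideal_uminus: "p \<in> uea_ideal L \<Longrightarrow> - p \<in> uea_ideal L"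
proof -
  show "0 \<in> uea_ideal L"
    using subgroup.one_closed[OF uea_ideal.a_subgroup] by simp
  show "p + q \<in> uea_ideal L" if "p \<in> uea_ideal L" "q \<in> uea_ideal L"
    using subgroup.m_closed[OF uea_ideal.a_subgroup that] by simp
  show "- p \<in> uea_ideal L" if "p \<in> uea_ideal L"
    using uea_ideal.I_l_closed[OF that, of "- 1"] by (simp add: free_algebra_uminus free_algebra_one)
qed

lemma carrier_uea: "carrier (uea L) = uea_class L ` carrier (free_algebra (carrier L))"
  by (auto simp: uea_def FactRing_def A_RCOSETS_def' uea_class_def)

lemma uea_class_closed [simp]:
  "p \<in> carrier (free_algebra (carrier L)) \<Longrightarrow> uea_class L p \<in> carrier (uea L)"
  by (simp add: carrier_uea)

lemma uea_class_add:
  assumes "p \<in> carrier (free_algebra (carrier L))" "q \<in> carrier (free_algebra (carrier L))"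
  shows "uea_class L p \<oplus>\<^bsub>uea L\<^esub> uea_class L q = uea_class L (p + q)"
  using uea_ideal.a_rcos_sum[OF assms] by (simp add: uea_def uea_class_def FactRing_def)

lemma uea_class_mult:
  assumes "p \<in> carrier (free_algebra (carrier L))" "q \<in> carrier (free_algebra (carrier L))"
  shows "uea_class L p \<otimes>\<^bsub>uea L\<^esub> uea_class L q = uea_class L (p * q)"
  using uea_ideal.rcoset_mult_add[OF assms] by (simp add: uea_def uea_class_def FactRing_def)

lemma ring_uea: "ring (uea L)"
  unfolding uea_def by (rule uea_ideal.quotient_is_ring)

lemma mem_uea_class:
  "q \<in> uea_class L p \<longleftrightarrow> (\<exists>i \<in> uea_ideal L. q = i + p)"
  by (auto simp: uea_class_def a_r_coset_def')

lemma self_mem_uea_class: "p \<in> uea_class L p"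
  unfolding mem_uea_class by (rule bexI[OF _ uea_ideal_zero]) simp

lemma bracket_space_subspace:
  assumes "C \<subseteq> carrier L"
    and "\<And>x y. x \<in> C \<Longrightarrow> y \<in> C \<Longrightarrow> x \<oplus> y \<in> C" "\<And>c x. x \<in> C \<Longrightarrow> c \<odot> x \<in> C"
    and "\<And>x y. x \<in> C \<Longrightarrow> y \<in> C \<Longrightarrow> lie_bracket L x y \<in> C"
  shows "bracket_space (L\<lparr>carrier := C\<rparr>)"
  by unfold_locales (use assms in auto)

text \<open>The part of the ideal of \<open>L\<close> lying in the free algebra on \<open>C\<close> is an ideal there, and it contains the
relations of \<open>C\<close>. This is what makes \<^const>\<open>uea_incl\<close> send cosets to cosets.\<close>

lemma uea_ideal_subspace:
  assumes C: "C \<subseteq> carrier L" and K: "bracket_space (L\<lparr>carrier := C\<rparr>)"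
  shows "uea_ideal (L\<lparr>carrier := C\<rparr>) \<subseteq> uea_ideal L"
proof -
  let ?F = "free_algebra C" and ?J = "uea_ideal L \<inter> carrier (free_algebra C)"
  interpret K: bracket_space "L\<lparr>carrier := C\<rparr>" by fact
  interpret F: ring ?F by (rule ring_free_algebra)
  have sub: "carrier ?F \<subseteq> carrier (free_algebra (carrier L))"
    using C by (fastforce simp: mem_free_algebra)
  have minus: "\<ominus>\<^bsub>?F\<^esub> p = - p" if "p \<in> carrier ?F" for p
    using that by (intro F.minus_equality) (auto intro: free_algebra_uminus)
  have "ideal ?J ?F"
  proof (rule idealI[OF ring_free_algebra])
    show "subgroup ?J (add_monoid ?F)"
    proof (rule F.add.subgroupI)
      show "?J \<noteq> {}"
        using uea_ideal_zero free_algebra_zero[of C] by auto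
      show "a \<oplus>\<^bsub>?F\<^esub> b \<in> ?J" if "a \<in> ?J" "b \<in> ?J" for a b
        using that by (auto intro: free_algebra_add uea_ideal_add)
    qed (auto simp: minus intro: free_algebra_uminus uea_ideal_uminus)
    show "x \<otimes>\<^bsub>?F\<^esub> a \<in> ?J" "a \<otimes>\<^bsub>?F\<^esub> x \<in> ?J" if "a \<in> ?J" "x \<in> carrier ?F" for a x
      using that sub uea_ideal.I_l_closed[of a x] uea_ideal.I_r_closed[of a x]
      by (auto intro: free_algebra_mult)
  qed
  moreover have "uea_relations (L\<lparr>carrier := C\<rparr>) \<subseteq> uea_relations L"
    using C unfolding uea_relations_def by (intro Un_mono) (simp, blast)+
  then have "uea_relations (L\<lparr>carrier := C\<rparr>) \<subseteq> ?J"
    using K.uea_relations_subset ring.genideal_self[OF ring_free_algebra uea_relations_subset]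
    by (intro Int_greatest) (auto simp: uea_ideal_def)
  ultimately have "genideal ?F (uea_relations (L\<lparr>carrier := C\<rparr>)) \<subseteq> ?J"
    by (rule F.genideal_minimal)
  then show ?thesis
    by (simp add: uea_ideal_def)
qed

lemma uea_incl_class:
  assumes C: "C \<subseteq> carrier L" and K: "bracket_space (L\<lparr>carrier := C\<rparr>)"
  shows "uea_incl L (uea_class (L\<lparr>carrier := C\<rparr>) p) = uea_class L p"
proof (intro equalityI subsetI)
  interpret K: bracket_space "L\<lparr>carrier := C\<rparr>" by fact
  note sub = uea_ideal_subspace[OF assms]
  fix q
  show "q \<in> uea_class L p" if q: "q \<in> uea_incl L (uea_class (L\<lparr>carrier := C\<rparr>) p)"
  proof -
    obtain i k where ik: "i \<in> uea_ideal L" "k \<in> uea_ideal (L\<lparr>carrier := C\<rparr>)" "q = i + (k + p)"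
      using q by (auto simp: uea_incl_def set_add_def' K.mem_uea_class)
    then have "i + k \<in> uea_ideal L" "q = (i + k) + p"
      using uea_ideal_add[of i k] sub by (auto simp: add.assoc)
    then show ?thesis
      unfolding mem_uea_class by blast
  qed
  show "q \<in> uea_incl L (uea_class (L\<lparr>carrier := C\<rparr>) p)" if q: "q \<in> uea_class L p"
  proof -
    obtain i where "i \<in> uea_ideal L" "q = i + p"
      using q by (auto simp: mem_uea_class)
    then show ?thesis
      using K.self_mem_uea_class[of p] by (auto simp: uea_incl_def set_add_def')
  qed
qed

end

text \<open>Each of the three families of relations is one of the axioms of a representation, read
as a statement about the free algebra.\<close>

lemma (in lie_rep) free_act_uea_ideal:
  assumes L: "bracket_space L" and p: "p \<in> uea_ideal L" and v: "v \<in> carrier V"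
  shows "free_act V \<rho> p v = \<zero>"
proof -
  interpret L: bracket_space L by fact
  let ?A = "{p \<in> carrier (free_algebra (carrier L)). \<forall>v \<in> carrier V. free_act V \<rho> p v = \<zero>}"
  have "free_act V \<rho> r v = \<zero>" if r: "r \<in> uea_relations L" and v: "v \<in> carrier V" for r v
    using r unfolding uea_relations_def
  proof (elim UnE CollectE exE conjE)
    fix x y assume "r = letter (x \<oplus>\<^bsub>L\<^esub> y) - (letter x + letter y)" "x \<in> carrier L" "y \<in> carrier L"
    then show ?thesis
      using v by (simp add: free_act_diff free_act_add free_act_letter free_algebra_closed add_act
          L.sum_closed act_closed a_minus_def r_neg)
  next
    fix c x assume "r = letter (c \<odot>\<^bsub>L\<^esub> x) - pm_scale c (letter x)" "x \<in> carrier L"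
    moreover from this have "pm_scale c (letter x) \<in> carrier (free_algebra (carrier L))"
      "free_act V \<rho> (pm_scale c (letter x)) v = c \<odot> \<rho> x v"
      using v by (simp_all add: letter_def free_algebra_single free_act_single)
    ultimately show ?thesis
      using v by (simp add: free_act_diff free_act_letter free_algebra_closed smult_act
          L.scale_closed act_closed a_minus_def r_neg)
  next
    fix x y assume "r = letter x * letter y - letter y * letter x - letter (lie_bracket L x y)"
      "x \<in> carrier L" "y \<in> carrier L"
    then show ?thesis
      using v by (simp add: free_act_diff free_act_mult free_act_letter free_algebra_closed bracket_act
          L.bracket_closed act_closed a_minus_def r_neg)
  qed
  then have "uea_relations L \<subseteq> ?A"
    using L.uea_relations_subset by blast
  then have "uea_ideal L \<subseteq> ?A"
    unfolding uea_ideal_def by (rule ring.genideal_minimal[OF ring_free_algebra ideal_annihilator])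
  then show ?thesis using p v by blast
qed

lemma (in lie_rep) uea_act_class:
  assumes L: "bracket_space L" and p: "p \<in> carrier (free_algebra (carrier L))" and v: "v \<in> carrier V"
  shows "uea_act V \<rho> (uea_class L p) v = free_act V \<rho> p v"
proof -
  interpret L: bracket_space L by fact
  have "free_act V \<rho> q v = free_act V \<rho> p v" if "q \<in> uea_class L p" for q
    using that p v L.uea_ideal_subset
    by (auto simp: L.mem_uea_class free_act_add free_act_uea_ideal[OF L] subset_iff)
  then have "(\<lambda>q. free_act V \<rho> q v) ` uea_class L p = {free_act V \<rho> p v}"
    using L.self_mem_uea_class[of p] by blast
  then show ?thesis by (simp add: uea_act_def)
qed

lemma free_act_hom:
  assumes "lie_rep L V \<rho>" "lie_rep L W \<sigma>" and f: "f \<in> rep_hom L V \<rho> W \<sigma>"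
    and p: "p \<in> carrier (free_algebra (carrier L))" and v: "v \<in> carrier V"
  shows "f (free_act V \<rho> p v) = free_act W \<sigma> p (f v)"
proof -
  interpret V: lie_rep L V \<rho> by fact
  interpret W: lie_rep L W \<sigma> by fact
  have closed: "f u \<in> carrier W" if "u \<in> carrier V" for u
    using f that by (auto simp: rep_hom_def)
  have sum: "f (u \<oplus>\<^bsub>V\<^esub> w) = f u \<oplus>\<^bsub>W\<^esub> f w" if "u \<in> carrier V" "w \<in> carrier V" for u w
    using f that by (auto simp: rep_hom_def)
  have scale: "f (c \<odot>\<^bsub>V\<^esub> u) = c \<odot>\<^bsub>W\<^esub> f u" if "u \<in> carrier V" for c u
    using f that by (auto simp: rep_hom_def)
  have act: "f (\<rho> x u) = \<sigma> x (f u)" if "x \<in> carrier L" "u \<in> carrier V" for x u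
    using f that by (auto simp: rep_hom_def)
  have foldr: "f (foldr \<rho> xs v) = foldr \<sigma> xs (f v)" if "set xs \<subseteq> carrier L" for xs
    using that by (induction xs) (auto simp: act V.foldr_act_closed v)
  show ?thesis
    using p
  proof (induction p rule: free_algebra_induct)
    case (single w c)
    then show ?case
      using v by (simp add: V.free_act_single W.free_act_single closed foldr scale V.foldr_act_closed)
  next
    case (add p q)
    then show ?case
      using v by (simp add: V.free_act_add W.free_act_add closed sum)
  qed
qed

section \<open>Tensor products\<close>

text \<open>The tensor product is generated by pairs and divided by relations; these closure conditions put the
relations inside the group generated by the pairs.\<close>

locale tensor_data =
  fixes R :: "('r, 'a) ring_scheme" and M :: "('m, 'b) ring_scheme" and r :: "'m \<Rightarrow> 'r \<Rightarrow> 'm"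
    and N :: "('n, 'c) ring_scheme" and l :: "'r \<Rightarrow> 'n \<Rightarrow> 'n"
  assumes M_add: "\<lbrakk>x \<in> carrier M; x' \<in> carrier M\<rbrakk> \<Longrightarrow> x \<oplus>\<^bsub>M\<^esub> x' \<in> carrier M"
    and N_add: "\<lbrakk>y \<in> carrier N; y' \<in> carrier N\<rbrakk> \<Longrightarrow> y \<oplus>\<^bsub>N\<^esub> y' \<in> carrier N"
    and M_act: "\<lbrakk>x \<in> carrier M; a \<in> carrier R\<rbrakk> \<Longrightarrow> r x a \<in> carrier M"
    and N_act: "\<lbrakk>a \<in> carrier R; y \<in> carrier N\<rbrakk> \<Longrightarrow> l a y \<in> carrier N"
begin

abbreviation Pairs where "Pairs \<equiv> free_Abelian_group (carrier M \<times> carrier N)"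

abbreviation Rels where "Rels \<equiv> generate Pairs (tensor_relations R M r N l)"

abbreviation T where "T \<equiv> tensor_product R M r N l"

sublocale Pairs: comm_group Pairs
  by (rule abelian_free_Abelian_group)

lemma relations_subset: "tensor_relations R M r N l \<subseteq> carrier Pairs"
proof -
  have add: "a \<in> carrier Pairs \<Longrightarrow> b \<in> carrier Pairs \<Longrightarrow> a + b \<in> carrier Pairs" for a b
    using keys_add[of a b] by auto
  have diff: "a \<in> carrier Pairs \<Longrightarrow> b \<in> carrier Pairs \<Longrightarrow> a - b \<in> carrier Pairs" for a b
    using keys_diff[of a b] by auto
  show ?thesis
    unfolding tensor_relations_def
    by (auto intro!: diff add M_add N_add M_act N_act simp del: carrier_free_Abelian_group_iff
        simp: frag_of_in_free_Abelian_group)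
qed

lemma subgroup_Rels: "subgroup Rels Pairs"
  by (rule Pairs.generate_is_subgroup[OF relations_subset])

sublocale Rels: normal Rels Pairs
  by (rule Pairs.normal_iff_subgroup[THEN iffD2, OF subgroup_Rels])

lemma carrier_tensor: "carrier T = (\<lambda>p. Rels #>\<^bsub>Pairs\<^esub> p) ` carrier Pairs"
  by (simp add: tensor_product_def carrier_FactGroup)

lemma comm_group_tensor: "comm_group T"
  unfolding tensor_product_def by (rule Pairs.abelian_FactGroup[OF subgroup_Rels])

text \<open>A biadditive map extends to the free abelian group on pairs; if it is balanced, the extension
vanishes on the relations and descends to the quotient.\<close>

lemma tensor_universal:
  fixes G (structure)
  assumes G: "comm_group G"
    and closed: "\<And>x y. \<lbrakk>x \<in> carrier M; y \<in> carrier N\<rbrakk> \<Longrightarrow> b x y \<in> carrier G"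
    and left: "\<And>x x' y. \<lbrakk>x \<in> carrier M; x' \<in> carrier M; y \<in> carrier N\<rbrakk> \<Longrightarrow>
          b (x \<oplus>\<^bsub>M\<^esub> x') y = b x y \<otimes> b x' y"
    and right: "\<And>x y y'. \<lbrakk>x \<in> carrier M; y \<in> carrier N; y' \<in> carrier N\<rbrakk> \<Longrightarrow>
          b x (y \<oplus>\<^bsub>N\<^esub> y') = b x y \<otimes> b x y'"
    and balanced: "\<And>x a y. \<lbrakk>x \<in> carrier M; a \<in> carrier R; y \<in> carrier N\<rbrakk> \<Longrightarrow>
          b (r x a) y = b x (l a y)"
  obtains g where "g \<in> hom T G"
    "\<And>x y. \<lbrakk>x \<in> carrier M; y \<in> carrier N\<rbrakk> \<Longrightarrow> g (Rels #>\<^bsub>Pairs\<^esub> frag_of (x, y)) = b x y"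
proof -
  interpret G: comm_group G by fact
  have "case_prod b ` (carrier M \<times> carrier N) \<subseteq> carrier G"
    using closed by auto
  then obtain h where h: "h \<in> hom Pairs G"
    and "\<And>z. z \<in> carrier M \<times> carrier N \<Longrightarrow> h (frag_of z) = case_prod b z"
    by (rule G.free_Abelian_group_universal) blast
  then have h_of: "h (frag_of (x, y)) = b x y" if "x \<in> carrier M" "y \<in> carrier N" for x y
    using that by force
  interpret h: group_hom Pairs G h
    by (intro group_hom.intro group_hom_axioms.intro h Pairs.group_axioms G.group_axioms)
  have h_add: "h (p + q) = h p \<otimes> h q" if "p \<in> carrier Pairs" "q \<in> carrier Pairs" for p q
    using h.hom_mult[OF that] by simp
  have h_diff: "h (p - q) = h p \<otimes> inv (h q)" if "p \<in> carrier Pairs" "q \<in> carrier Pairs" for p q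
  proof -
    have "- q \<in> carrier Pairs" "h (- q) = inv (h q)"
      using that h.hom_inv[of q] by simp_all
    then show ?thesis using h_add[of p "- q"] that by simp
  qed
  have of_closed: "frag_of (x, y) \<in> carrier Pairs" if "x \<in> carrier M" "y \<in> carrier N" for x y
    using that by simp
  have plus_closed: "p + q \<in> carrier Pairs" if "p \<in> carrier Pairs" "q \<in> carrier Pairs" for p q
    using Pairs.m_closed[OF that] by simp
  note simps = h_diff h_add h_of of_closed plus_closed closed left right balanced M_add N_add M_act N_act
  have "h p = \<one>" if "p \<in> tensor_relations R M r N l" for p
    using that unfolding tensor_relations_def
    by (elim UnE CollectE exE conjE) (simp_all add: simps del: carrier_free_Abelian_group_iff)
  then have "tensor_relations R M r N l \<subseteq> kernel Pairs G h"
    using relations_subset by (auto simp: kernel_def simp del: carrier_free_Abelian_group_iff)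
  then have "Rels \<subseteq> kernel Pairs G h"
    by (rule Pairs.generate_subgroup_incl[OF _ h.subgroup_kernel])
  then obtain g where g: "g \<in> hom T G"
    "\<And>p. p \<in> carrier Pairs \<Longrightarrow> g (Rels #>\<^bsub>Pairs\<^esub> p) = h p"
    using h.FactGroup_universal_kernel[OF Rels.normal_axioms] unfolding tensor_product_def by blast
  show ?thesis
  proof (rule that[OF g(1)])
    show "g (Rels #>\<^bsub>Pairs\<^esub> frag_of (x, y)) = b x y" if "x \<in> carrier M" "y \<in> carrier N" for x y
      using g(2)[OF of_closed[OF that]] h_of[OF that] by (rule trans)
  qed
qed

end

text \<open>An endomorphism of the right module \<open>M\<close>. It acts on pairs through the first component and respects the
relations, hence it acts on the tensor product.\<close>

locale tensor_endo = tensor_data +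
  fixes h
  assumes h_closed: "x \<in> carrier M \<Longrightarrow> h x \<in> carrier M"
    and h_add: "\<lbrakk>x \<in> carrier M; x' \<in> carrier M\<rbrakk> \<Longrightarrow> h (x \<oplus>\<^bsub>M\<^esub> x') = h x \<oplus>\<^bsub>M\<^esub> h x'"
    and h_act: "\<lbrakk>x \<in> carrier M; a \<in> carrier R\<rbrakk> \<Longrightarrow> h (r x a) = r (h x) a"
begin

abbreviation H where "H \<equiv> frag_extend (\<lambda>(x, y). frag_of (h x, y))"

lemma H_closed: "p \<in> carrier Pairs \<Longrightarrow> H p \<in> carrier Pairs"
  using keys_frag_extend[of "\<lambda>(x, y). frag_of (h x, y)" p] h_closed by fastforce

lemma H_Rels: "p \<in> Rels \<Longrightarrow> H p \<in> Rels"
proof (induction p rule: generate.induct)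
  case one
  then show ?case using generate.one[of Pairs] by simp
next
  have rel: "H p \<in> tensor_relations R M r N l" if "p \<in> tensor_relations R M r N l" for p
    using that unfolding tensor_relations_def
  proof (elim UnE CollectE exE conjE, goal_cases)
    case (1 x x' y)
    then have "H p = frag_of (h x \<oplus>\<^bsub>M\<^esub> h x', y) - (frag_of (h x, y) + frag_of (h x', y))"
      by (simp add: frag_extend_diff frag_extend_add h_add)
    then show ?case using 1 h_closed by blast
  next
    case (2 x y y')
    then have "H p = frag_of (h x, y \<oplus>\<^bsub>N\<^esub> y') - (frag_of (h x, y) + frag_of (h x, y'))"
      by (simp add: frag_extend_diff frag_extend_add)
    then show ?case using 2 h_closed by blast
  next
    case (3 x a y)
    then have "H p = frag_of (r (h x) a, y) - frag_of (h x, l a y)"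
      by (simp add: frag_extend_diff h_act)
    then show ?case using 3 h_closed by blast
  qed
  {
    case (incl p)
    then show ?case by (simp add: rel generate.incl)
  next
    case (inv p)
    then have "inv\<^bsub>Pairs\<^esub> (H p) \<in> Rels" by (simp add: rel generate.inv)
    moreover have "p \<in> carrier Pairs" "H p \<in> carrier Pairs"
      using relations_subset inv H_closed by blast+
    ultimately show ?case by (simp add: frag_extend_minus)
  }
next
  case (eng p q)
  then show ?case using generate.eng[of "H p" Pairs _ "H q"] by (simp add: frag_extend_add)
qed

lemma tensor_map_left_coset:
  assumes p: "p \<in> carrier Pairs"
  shows "tensor_map_left M N T h (Rels #>\<^bsub>Pairs\<^esub> p) = Rels #>\<^bsub>Pairs\<^esub> H p"
proof -
  have one: "\<one>\<^bsub>T\<^esub> = Rels" by (simp add: tensor_product_def)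
  have "Rels <#>\<^bsub>Pairs\<^esub> H ` (Rels #>\<^bsub>Pairs\<^esub> p) = Rels #>\<^bsub>Pairs\<^esub> H p"
  proof (intro equalityI subsetI)
    fix q assume "q \<in> Rels <#>\<^bsub>Pairs\<^esub> H ` (Rels #>\<^bsub>Pairs\<^esub> p)"
    then obtain a c where "a \<in> Rels" "c \<in> Rels" "q = a + H (c + p)"
      by (auto simp: set_mult_def r_coset_def)
    then have "a + H c \<in> Rels" "q = (a + H c) + H p"
      using generate.eng[of a Pairs _ "H c"] H_Rels by (auto simp: frag_extend_add add.assoc)
    then show "q \<in> Rels #>\<^bsub>Pairs\<^esub> H p"
      by (auto simp: r_coset_def)
  next
    fix q assume "q \<in> Rels #>\<^bsub>Pairs\<^esub> H p"
    then obtain a where a: "a \<in> Rels" "q = a \<otimes>\<^bsub>Pairs\<^esub> H p"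
      by (auto simp: r_coset_def)
    have "H p \<in> H ` (Rels #>\<^bsub>Pairs\<^esub> p)"
      by (rule imageI[OF Pairs.rcos_self[OF p subgroup_Rels]])
    then show "q \<in> Rels <#>\<^bsub>Pairs\<^esub> H ` (Rels #>\<^bsub>Pairs\<^esub> p)"
      using a unfolding set_mult_def by blast
  qed
  then show ?thesis by (simp add: tensor_map_left_def one)
qed

lemma tensor_map_left_closed: "A \<in> carrier T \<Longrightarrow> tensor_map_left M N T h A \<in> carrier T"
  by (auto simp: carrier_tensor tensor_map_left_coset H_closed simp del: carrier_free_Abelian_group_iff)

text \<open>Elementary tensors generate the tensor product, so an identity between additive maps need only
be checked on them.\<close>

lemma tensor_map_left_equivariant:
  fixes G (structure)
  assumes G: "comm_group G" and g: "g \<in> hom T G" and k: "k \<in> hom G G"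
    and eq: "\<And>x y. \<lbrakk>x \<in> carrier M; y \<in> carrier N\<rbrakk> \<Longrightarrow>
       g (Rels #>\<^bsub>Pairs\<^esub> frag_of (h x, y)) = k (g (Rels #>\<^bsub>Pairs\<^esub> frag_of (x, y)))"
    and A: "A \<in> carrier T"
  shows "g (tensor_map_left M N T h A) = k (g A)"
proof -
  interpret G: comm_group G by fact
  have c: "(\<lambda>p. Rels #>\<^bsub>Pairs\<^esub> p) \<in> hom Pairs T"
    unfolding tensor_product_def by (rule Rels.r_coset_hom_Mod)
  have H: "H \<in> hom Pairs Pairs"
    by (rule homI) (auto simp: frag_extend_add H_closed simp del: carrier_free_Abelian_group_iff)
  let ?a = "\<lambda>p. g (Rels #>\<^bsub>Pairs\<^esub> H p)" and ?b = "\<lambda>p. k (g (Rels #>\<^bsub>Pairs\<^esub> p))"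
  have "?a \<in> hom Pairs G"
    using hom_compose[OF hom_compose[OF H c] g] by (simp add: comp_def)
  then interpret a: group_hom Pairs G ?a
    by (intro group_hom.intro group_hom_axioms.intro Pairs.group_axioms G.group_axioms)
  have "?b \<in> hom Pairs G"
    using hom_compose[OF hom_compose[OF c g] k] by (simp add: comp_def)
  then interpret b: group_hom Pairs G ?b
    by (intro group_hom.intro group_hom_axioms.intro Pairs.group_axioms G.group_axioms)
  have "?a p = ?b p" if "p \<in> carrier Pairs" for p
  proof -
    have "Poly_Mapping.keys p \<subseteq> carrier M \<times> carrier N" using that by simp
    then show ?thesis
    proof (induction p rule: free_Abelian_group_induct[consumes 1, case_names zero diff generator])
      case zero
      then show ?case using a.hom_one b.hom_one by simp
    next
      case (diff p q)
      then have "- q \<in> carrier Pairs" "p \<in> carrier Pairs" "q \<in> carrier Pairs" by auto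
      then show ?case
        using diff a.hom_mult[of p "- q"] b.hom_mult[of p "- q"] a.hom_inv[of q] b.hom_inv[of q]
        by simp
    next
      case (generator z)
      then show ?case by (cases z) (auto simp: eq)
    qed
  qed
  then show ?thesis
    using A by (auto simp: carrier_tensor tensor_map_left_coset simp del: carrier_free_Abelian_group_iff)
qed

end

section \<open>The lower subalgebra and its weights\<close>

abbreviation lower_gens :: "ie_gen set" where
  "lower_gens \<equiv> insert DGrade (Set.range DMinus)"

lemma ie_algebra_simps [simp]:
  "carrier ie_algebra = UNIV" "x \<oplus>\<^bsub>ie_algebra\<^esub> y = x + y" "c \<odot>\<^bsub>ie_algebra\<^esub> x = pm_scale c x"
  "lie_bracket ie_algebra x y = ie_bracket x y"
  by (simp_all add: ie_algebra_def)

lemma keys_pm_scale: "Poly_Mapping.keys (pm_scale c p) \<subseteq> Poly_Mapping.keys p"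
  by (auto simp: in_keys_iff)

text \<open>No bracket of two lower generators has a component along \<^const>\<open>DGrade\<close>. Hence the lower part is closed
under the bracket, and a weight is a character of it. The sum over trees in the bracket of two
elimination operators is either a finite sum or, by convention, zero, and the
bound on its support holds in both cases.\<close>

lemma keys_gen_bracket_lower:
  assumes "a \<in> lower_gens" "b \<in> lower_gens"
  shows "Poly_Mapping.keys (gen_bracket a b) \<subseteq> Set.range DMinus"
proof -
  have sum: "Poly_Mapping.keys (Sum_any (\<lambda>t. gen (f t) (DMinus t))) \<subseteq> Set.range DMinus" for f
    unfolding Sum_any.expand_set
    by (rule order_trans[OF keys_sum]) (auto split: if_splits)
  show ?thesis
    using assms by (auto split: if_splits dest: subsetD[OF sum])
qed

lemma keys_ie_bracket_lower:
  assumes "Poly_Mapping.keys x \<subseteq> lower_gens" "Poly_Mapping.keys y \<subseteq> lower_gens"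
  shows "Poly_Mapping.keys (ie_bracket x y) \<subseteq> Set.range DMinus"
proof -
  have "Poly_Mapping.keys (pm_scale c (gen_bracket a b)) \<subseteq> Set.range DMinus"
    if "a \<in> Poly_Mapping.keys x" "b \<in> Poly_Mapping.keys y" for a b c
    using that assms keys_pm_scale keys_gen_bracket_lower by (meson subset_eq)
  then show ?thesis
    unfolding ie_bracket_def
    by (intro order_trans[OF keys_sum] UN_least) simp
qed

lemma bracket_space_ie_algebra: "bracket_space ie_algebra"
  by unfold_locales simp_all

lemma carrier_ie_lower: "carrier ie_lower = {x. Poly_Mapping.keys x \<subseteq> lower_gens}"
  by (simp add: ie_lower_def)

lemma bracket_space_ie_lower: "bracket_space ie_lower"
  unfolding ie_lower_def
proof (rule bracket_space.bracket_space_subspace[OF bracket_space_ie_algebra])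
  show "x \<oplus>\<^bsub>ie_algebra\<^esub> y \<in> {x. Poly_Mapping.keys x \<subseteq> lower_gens}"
    if "x \<in> {x. Poly_Mapping.keys x \<subseteq> lower_gens}" "y \<in> {x. Poly_Mapping.keys x \<subseteq> lower_gens}" for x y
    using that keys_add[of x y] by auto
  show "c \<odot>\<^bsub>ie_algebra\<^esub> x \<in> {x. Poly_Mapping.keys x \<subseteq> lower_gens}"
    if "x \<in> {x. Poly_Mapping.keys x \<subseteq> lower_gens}" for c x
    using that keys_pm_scale[of c x] by auto
  show "lie_bracket ie_algebra x y \<in> {x. Poly_Mapping.keys x \<subseteq> lower_gens}"
    if "x \<in> {x. Poly_Mapping.keys x \<subseteq> lower_gens}" "y \<in> {x. Poly_Mapping.keys x \<subseteq> lower_gens}" for x y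
    using that keys_ie_bracket_lower[of x y] by auto
qed simp

lemma uea_incl_lower: "uea_incl ie_algebra (uea_class ie_lower p) = uea_class ie_algebra p"
  unfolding ie_lower_def
  by (rule bracket_space.uea_incl_class[OF bracket_space_ie_algebra])
     (simp_all flip: ie_lower_def add: bracket_space_ie_lower)

lemma complex_line_simps [simp]:
  "carrier complex_line = UNIV" "x \<oplus>\<^bsub>complex_line\<^esub> y = x + y" "c \<odot>\<^bsub>complex_line\<^esub> x = c * x"
  "\<zero>\<^bsub>complex_line\<^esub> = 0"
  by (simp_all add: complex_line_def)

lemma cring_complex_ring: "cring complex_ring"
proof (rule cringI)
  show "abelian_group complex_ring"
    by (rule abelian_groupI) (auto simp: add_ac intro: exI[of _ "- x" for x] add.left_inverse)
  show "comm_monoid complex_ring"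
    by (rule comm_monoidI) (auto simp: mult_ac)
qed (auto simp: distrib_right)

text \<open>A one-dimensional representation must kill all brackets. Here it does because brackets in the lower
subalgebra have no component along \<^const>\<open>DGrade\<close>.\<close>

lemma lie_rep_weight: "lie_rep ie_lower complex_line (weight_act lam)"
proof -
  have group: "abelian_group complex_line"
    by (rule abelian_groupI) (auto simp: add_ac intro: exI[of _ "- x" for x] add.left_inverse)
  interpret module complex_ring complex_line
    by (rule moduleI[OF cring_complex_ring group]) (auto simp: algebra_simps complex_ring_def complex_line_def)
  show ?thesis
  proof
    fix x y z
    assume x: "x \<in> carrier ie_lower" and y: "y \<in> carrier ie_lower"
    have "DGrade \<notin> Poly_Mapping.keys (ie_bracket x y)"
      using keys_ie_bracket_lower[of x y] x y by (auto simp: carrier_ie_lower)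
    then have "weight_act lam (lie_bracket ie_lower x y) z = 0"
      by (simp add: weight_act_def ie_lower_def in_keys_iff)
    moreover have "weight_act lam x (weight_act lam y z) = weight_act lam y (weight_act lam x z)"
      by (simp add: weight_act_def)
    ultimately show "weight_act lam (lie_bracket ie_lower x y) z =
        weight_act lam x (weight_act lam y z) \<ominus>\<^bsub>complex_line\<^esub> weight_act lam y (weight_act lam x z)"
      using M.r_neg by (simp add: a_minus_def)
  qed (auto simp: weight_act_def ie_lower_def lookup_add algebra_simps)
qed

lemma lie_rep_subspace:
  assumes "lie_rep L V \<rho>" "C \<subseteq> carrier L"
  shows "lie_rep (L\<lparr>carrier := C\<rparr>) V \<rho>"
proof -
  interpret lie_rep L V \<rho> by fact
  show ?thesis
    using assms(2)
    by unfold_locales (auto simp: act_closed act_add act_smult add_act smult_act bracket_act subset_iff)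
qed

section \<open>Lowest-weight vectors\<close>

text \<open>The zero vector is admitted; it corresponds to the zero homomorphism from the Verma module.\<close>

definition lowest_weight_vector ::
  "(complex, 'v, 'n) module_scheme \<Rightarrow> (ie \<Rightarrow> 'v \<Rightarrow> 'v) \<Rightarrow> complex \<Rightarrow> 'v \<Rightarrow> bool" where
  "lowest_weight_vector V \<rho> lam v \<longleftrightarrow> v \<in> d_eigenspace V \<rho> lam \<and>
     (\<forall>t. \<rho> (gen 1 (DMinus t)) v = \<zero>\<^bsub>V\<^esub>)"

text \<open>The line through a lowest-weight vector is an image of the one-dimensional representation from which
the Verma module is induced.\<close>

lemma lower_acts_by_weight:
  assumes "lie_rep ie_algebra V \<rho>" and low: "lowest_weight_vector V \<rho> lam v" and x: "x \<in> carrier ie_lower"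
  shows "\<rho> x v = (Poly_Mapping.lookup x DGrade * lam) \<odot>\<^bsub>V\<^esub> v"
proof -
  interpret lie_rep ie_algebra V \<rho> by fact
  have v: "v \<in> carrier V" and d: "\<rho> (gen 1 DGrade) v = lam \<odot>\<^bsub>V\<^esub> v"
    and minus: "\<rho> (gen 1 (DMinus t)) v = \<zero>\<^bsub>V\<^esub>" for t
    using low by (auto simp: lowest_weight_vector_def d_eigenspace_def)
  have gen: "\<rho> (gen c a) v = c \<odot>\<^bsub>V\<^esub> \<rho> (gen 1 a) v" for c a
    using smult_act[of "gen 1 a" v c] v by simp
  have "Poly_Mapping.keys x \<subseteq> lower_gens"
    using x by (simp add: carrier_ie_lower)
  then show ?thesis
  proof (induction x rule: poly_mapping_induct_keys)
    case zero
    show ?case using gen[where c = 0 and a = DGrade] v act_closed[of "gen 1 DGrade" v] by (simp add: scal_zero)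
  next
    case (single a c)
    then show ?case
      using v smult_r_null[of c] by (auto simp: gen[where c = c] d minus lookup_single scal_scal scal_zero)
  next
    case (add x y)
    then show ?case
      using v by (simp add: add_act[simplified] lookup_add distrib_right scal_add_left)
  qed
qed

lemma rooted_tree_rep: "rooted_tree (rep_rtree t)"
  using Quotient3_rep_reflp[OF Quotient3_rtree] by blast

lemma card_verts_pos: "card (V\<^sub>t t) > 0"
  using rooted_tree_rep[of t] by (auto simp: V\<^sub>t_def rooted_tree_def card_gt_0_iff)

text \<open>The usual weight computation, from the relation
\<open>[d, D\<^sup>-\<^sub>t] = - |t| D\<^sup>-\<^sub>t\<close>.\<close>

lemma DMinus_lowers_weight:
  assumes "lie_rep ie_algebra V \<rho>" and v: "v \<in> d_eigenspace V \<rho> \<delta>"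
  shows "\<rho> (gen 1 (DMinus t)) v \<in> d_eigenspace V \<rho> (\<delta> - of_nat (card (V\<^sub>t t)))"
proof -
  interpret lie_rep ie_algebra V \<rho> by fact
  let ?d = "gen 1 DGrade" and ?x = "gen 1 (DMinus t)" and ?n = "of_nat (card (V\<^sub>t t)) :: complex"
  have vV: "v \<in> carrier V" and dv: "\<rho> ?d v = \<delta> \<odot>\<^bsub>V\<^esub> v"
    using v by (auto simp: d_eigenspace_def)
  note closed = act_closed[of ?x v] act_closed[of ?d "\<rho> ?x v"]
  have "(- ?n) \<odot>\<^bsub>V\<^esub> \<rho> ?x v = \<rho> (pm_scale (- ?n) ?x) v"
    using smult_act[of ?x v "- ?n"] vV by simp
  also have "pm_scale (- ?n) ?x = ie_bracket ?d ?x"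
    by (simp add: ie_bracket_def)
  also have "\<rho> (ie_bracket ?d ?x) v = \<rho> ?d (\<rho> ?x v) \<ominus>\<^bsub>V\<^esub> \<rho> ?x (\<rho> ?d v)"
    using bracket_act[of ?d ?x v] vV by simp
  also have "\<rho> ?x (\<rho> ?d v) = \<delta> \<odot>\<^bsub>V\<^esub> \<rho> ?x v"
    using act_smult[of ?x v \<delta>] vV by (simp add: dv)
  finally have "\<rho> ?d (\<rho> ?x v) = (- ?n) \<odot>\<^bsub>V\<^esub> \<rho> ?x v \<oplus>\<^bsub>V\<^esub> \<delta> \<odot>\<^bsub>V\<^esub> \<rho> ?x v"
    using closed vV by (simp add: a_minus_def a_assoc l_neg)
  then show ?thesis
    using closed vV by (simp add: d_eigenspace_def flip: scal_add_left)
qed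

text \<open>Starting from any weight \<open>\<delta>\<close> of the representation, only finitely many of \<open>\<delta>, \<delta> - 1, \<delta> - 2, \<dots>\<close> are weights,
because real parts are bounded below. The last of them is a lowest weight, since every \<open>D\<^sup>-\<^sub>t\<close>
lowers the weight by the positive integer \<open>|t|\<close>.\<close>

lemma category_O_lowest_weight_vector:
  assumes O: "category_O V \<rho>" and nz: "carrier V \<noteq> {\<zero>\<^bsub>V\<^esub>}"
  obtains lam v where "lowest_weight_vector V \<rho> lam v" "v \<noteq> \<zero>\<^bsub>V\<^esub>"
proof -
  have rep: "lie_rep ie_algebra V \<rho>" and decomp: "direct_sum_decomp V (d_eigenspace V \<rho>)"
    using O by (auto simp: category_O_def)
  obtain l where l: "\<And>\<delta>. d_eigenspace V \<rho> \<delta> \<noteq> {\<zero>\<^bsub>V\<^esub>} \<Longrightarrow> Re \<delta> \<ge> l"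
    using O by (auto simp: category_O_def)
  interpret lie_rep ie_algebra V \<rho> by fact
  have zero: "\<zero>\<^bsub>V\<^esub> \<in> d_eigenspace V \<rho> \<delta>" for \<delta>
    using decomp subgroup.one_closed[OF submodule.axioms(1)] by (fastforce simp: direct_sum_decomp_def)
  obtain u where u: "u \<in> carrier V" "u \<noteq> \<zero>\<^bsub>V\<^esub>"
    using nz M.zero_closed by blast
  obtain f where f: "\<And>i. f i \<in> d_eigenspace V \<rho> i"
    "u = (\<Oplus>\<^bsub>V\<^esub>i \<in> {i. f i \<noteq> \<zero>\<^bsub>V\<^esub>}. f i)"
    using decomp u(1) unfolding direct_sum_decomp_def by metis
  have "{i. f i \<noteq> \<zero>\<^bsub>V\<^esub>} \<noteq> {}"
    using f(2) u(2) by (metis finsum_empty)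
  then obtain \<delta> where \<delta>: "d_eigenspace V \<rho> \<delta> \<noteq> {\<zero>\<^bsub>V\<^esub>}"
    using f(1) by blast
  \<comment> \<open>The steps down from \<open>\<delta>\<close> that land on a weight; the largest one reaches the bottom.\<close>
  define N where "N = {n::nat. d_eigenspace V \<rho> (\<delta> - of_nat n) \<noteq> {\<zero>\<^bsub>V\<^esub>}}"
  have "n \<le> nat \<lceil>Re \<delta> - l\<rceil>" if "n \<in> N" for n
    using l[of "\<delta> - of_nat n"] that by (simp add: N_def) linarith
  then have fin: "finite N"
    by (meson finite_nat_set_iff_bounded_le)
  have "0 \<in> N" using \<delta> by (simp add: N_def)
  define n where "n = Max N"
  have n: "n \<in> N" "\<And>m. m \<in> N \<Longrightarrow> m \<le> n"
    using Max_in[OF fin] Max_ge[OF fin] \<open>0 \<in> N\<close> unfolding n_def by blast+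
  obtain v where v: "v \<in> d_eigenspace V \<rho> (\<delta> - of_nat n)" "v \<noteq> \<zero>\<^bsub>V\<^esub>"
    using n(1) zero by (auto simp: N_def)
  have "\<rho> (gen 1 (DMinus t)) v = \<zero>\<^bsub>V\<^esub>" for t
  proof -
    have "n + card (V\<^sub>t t) \<notin> N"
      using n(2) card_verts_pos[of t] by fastforce
    then have "d_eigenspace V \<rho> (\<delta> - of_nat n - of_nat (card (V\<^sub>t t))) = {\<zero>\<^bsub>V\<^esub>}"
      by (simp add: N_def diff_diff_eq)
    then show ?thesis
      using DMinus_lowers_weight[OF rep v(1)] by blast
  qed
  then show ?thesis
    using v by (intro that) (auto simp: lowest_weight_vector_def)
qed

section \<open>The universal property of Verma modules\<close>

interpretation ie: bracket_space ie_algebra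
  by (rule bracket_space_ie_algebra)

interpretation ie_lower: bracket_space ie_lower
  by (rule bracket_space_ie_lower)

text \<open>The Verma module is an instance of the general tensor product: a right factor of \<open>U(\<gg>)\<close> from the
lower subalgebra acts on the line. The weight is left as a parameter.\<close>

interpretation verma: tensor_data "uea ie_lower"
  "uea ie_algebra" "\<lambda>u a. u \<otimes>\<^bsub>uea ie_algebra\<^esub> uea_incl ie_algebra a"
  complex_line "uea_act complex_line (weight_act lam)" for lam
proof -
  interpret U: ring "uea ie_algebra" by (rule ie.ring_uea)
  show "tensor_data (uea ie_lower) (uea ie_algebra) (\<lambda>u a. u \<otimes>\<^bsub>uea ie_algebra\<^esub> uea_incl ie_algebra a)
    complex_line (uea_act complex_line (weight_act lam))"
    by unfold_locales (auto simp: ie_lower.carrier_uea uea_incl_lower mem_free_algebra)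
qed

text \<open>Left multiplication commutes with right multiplication, so \<open>U(\<gg>)\<close> acts on the tensor product through
its left factor.\<close>

lemma verma_endo:
  assumes "u \<in> carrier (uea ie_algebra)"
  shows "tensor_endo (uea ie_lower)
     (uea ie_algebra) (\<lambda>u a. u \<otimes>\<^bsub>uea ie_algebra\<^esub> uea_incl ie_algebra a)
     complex_line (uea_act complex_line (weight_act lam)) (\<lambda>x. u \<otimes>\<^bsub>uea ie_algebra\<^esub> x)"
proof -
  interpret U: ring "uea ie_algebra" by (rule ie.ring_uea)
  show ?thesis
    by unfold_locales
      (use assms in \<open>auto simp: ie_lower.carrier_uea uea_incl_lower mem_free_algebra U.r_distr U.m_assoc\<close>)
qed

lemma verma_uea_act_closed:
  assumes "u \<in> carrier (uea ie_algebra)" "A \<in> carrier (verma_tensor lam)"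
  shows "verma_uea_act lam u A \<in> carrier (verma_tensor lam)"
  using tensor_endo.tensor_map_left_closed[OF verma_endo[OF assms(1)]] assms(2)
  by (simp add: verma_uea_act_def verma_tensor_def)

lemma verma_closed:
  assumes "A \<in> carrier (verma lam)"
  shows "B \<in> carrier (verma lam) \<Longrightarrow> A \<oplus>\<^bsub>verma lam\<^esub> B \<in> carrier (verma lam)"
    "c \<odot>\<^bsub>verma lam\<^esub> A \<in> carrier (verma lam)"
    "verma_act lam x A \<in> carrier (verma lam)"
proof -
  interpret T: comm_group "verma_tensor lam"
    unfolding verma_tensor_def by (rule verma.comm_group_tensor)
  show "A \<oplus>\<^bsub>verma lam\<^esub> B \<in> carrier (verma lam)" if "B \<in> carrier (verma lam)"
    using assms that by (simp add: verma_def)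
  show "c \<odot>\<^bsub>verma lam\<^esub> A \<in> carrier (verma lam)"
    using assms(1) by (simp add: verma_def verma_uea_act_closed mem_free_algebra)
  show "verma_act lam x A \<in> carrier (verma lam)"
    using assms(1) by (simp add: verma_def verma_act_def verma_uea_act_closed mem_free_algebra)
qed

text \<open>Frobenius reciprocity: \<open>u \<otimes> z \<mapsto> u (z v)\<close> is balanced because \<open>z \<mapsto> z v\<close> is a map of representations of the
lower subalgebra, and it commutes with the left action of \<open>U(\<gg>)\<close>. The image of \<open>1 \<otimes> 1\<close> is \<open>v\<close>.\<close>

lemma verma_universal:
  assumes rep: "lie_rep ie_algebra V \<rho>" and low: "lowest_weight_vector V \<rho> lam v"
  obtains f where "f \<in> rep_hom ie_algebra (verma lam) (verma_act lam) V \<rho>"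
    "v \<in> f ` carrier (verma lam)"
proof -
  interpret lie_rep ie_algebra V \<rho> by fact
  interpret U: ring "uea ie_algebra" by (rule ie.ring_uea)
  interpret G: comm_group "add_monoid V" by (rule M.a_comm_group)
  have v: "v \<in> carrier V"
    using low by (simp add: lowest_weight_vector_def d_eigenspace_def)
  have rep_lower: "lie_rep ie_lower V \<rho>"
    unfolding ie_lower_def by (rule lie_rep_subspace[OF rep]) simp
  have line_hom: "(\<lambda>z. z \<odot>\<^bsub>V\<^esub> v) \<in> rep_hom ie_lower complex_line (weight_act lam) V \<rho>"
    using v act_smult[of _ v] lower_acts_by_weight[OF rep low]
    by (auto simp: rep_hom_def scal_add_left scal_scal weight_act_def mult_ac)
  have all: "p \<in> carrier (free_algebra (carrier ie_algebra))" for p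
    by (simp add: mem_free_algebra)
  note act_class = uea_act_class[OF bracket_space_ie_algebra all]
  \<comment> \<open>The scalar is applied before \<open>u\<close>, so that balancedness is literally associativity of the action.\<close>
  define b where "b u z = uea_act V \<rho> u (z \<odot>\<^bsub>V\<^esub> v)" for u z
  have b_closed: "b u z \<in> carrier V" if "u \<in> carrier (uea ie_algebra)" for u z
    using that v by (auto simp: b_def ie.carrier_uea act_class all)
  have b_left: "b (u \<oplus>\<^bsub>uea ie_algebra\<^esub> u') z = b u z \<oplus>\<^bsub>V\<^esub> b u' z"
    if "u \<in> carrier (uea ie_algebra)" "u' \<in> carrier (uea ie_algebra)" for u u' z
    using that v by (auto simp: b_def ie.carrier_uea ie.uea_class_add act_class all free_act_add)
  have b_right: "b u (z + z') = b u z \<oplus>\<^bsub>V\<^esub> b u z'" if "u \<in> carrier (uea ie_algebra)" for u z z'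
    using that v by (auto simp: b_def ie.carrier_uea act_class all free_act_add_vec scal_add_left)
  have b_mult: "b (uea_class ie_algebra p \<otimes>\<^bsub>uea ie_algebra\<^esub> u) z = free_act V \<rho> p (b u z)"
    if "u \<in> carrier (uea ie_algebra)" for p u z
    using that v by (auto simp: b_def ie.carrier_uea ie.uea_class_mult act_class all[simplified] all free_act_mult)
  have b_balanced: "b (u \<otimes>\<^bsub>uea ie_algebra\<^esub> uea_incl ie_algebra a) z
      = b u (uea_act complex_line (weight_act lam) a z)"
    if u: "u \<in> carrier (uea ie_algebra)" and a: "a \<in> carrier (uea ie_lower)" for u a z
  proof -
    obtain p q where p: "u = uea_class ie_algebra p"
      and q: "q \<in> carrier (free_algebra (carrier ie_lower))" "a = uea_class ie_lower q"
      using u a by (auto simp: ie.carrier_uea ie_lower.carrier_uea)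
    have "free_act V \<rho> q (z \<odot>\<^bsub>V\<^esub> v) = free_act complex_line (weight_act lam) q z \<odot>\<^bsub>V\<^esub> v"
      using free_act_hom[OF lie_rep_weight rep_lower line_hom q(1), of z] by simp
    then show ?thesis
      using v by (simp add: b_def p q(2) uea_incl_lower ie.uea_class_mult act_class all[simplified] all free_act_mult
          lie_rep.uea_act_class[OF lie_rep_weight bracket_space_ie_lower q(1)])
  qed
  obtain g where g: "g \<in> hom (verma_tensor lam) (add_monoid V)"
    and g_of: "\<And>u z. u \<in> carrier (uea ie_algebra) \<Longrightarrow>
      g (verma.Rels lam #>\<^bsub>verma.Pairs\<^esub> frag_of (u, z)) = b u z"
  proof (rule verma.tensor_universal[OF M.a_comm_group, of b lam])
  qed (use b_closed b_left b_right b_balanced in \<open>auto simp: verma_tensor_def\<close>)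
  have equivariant: "g (verma_uea_act lam (uea_class ie_algebra p) A) = free_act V \<rho> p (g A)"
    if A: "A \<in> carrier (verma_tensor lam)" for p A
  proof -
    interpret endo: tensor_endo "uea ie_lower"
      "uea ie_algebra" "\<lambda>u a. u \<otimes>\<^bsub>uea ie_algebra\<^esub> uea_incl ie_algebra a"
      complex_line "uea_act complex_line (weight_act lam)" "\<lambda>x. uea_class ie_algebra p \<otimes>\<^bsub>uea ie_algebra\<^esub> x"
      by (rule verma_endo[OF ie.uea_class_closed[OF all]])
    have "g (tensor_map_left (uea ie_algebra) complex_line (verma.T lam)
        (\<lambda>x. uea_class ie_algebra p \<otimes>\<^bsub>uea ie_algebra\<^esub> x) A) = free_act V \<rho> p (g A)"
    proof (rule endo.tensor_map_left_equivariant[OF M.a_comm_group])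
      show "g \<in> hom (verma.T lam) (add_monoid V)" "A \<in> carrier (verma.T lam)"
        using g A by (simp_all add: verma_tensor_def)
      show "free_act V \<rho> p \<in> hom (add_monoid V) (add_monoid V)"
        by (rule homI) (simp_all add: free_act_closed[OF all] free_act_add_vec[OF all])
      show "g (verma.Rels lam #>\<^bsub>verma.Pairs\<^esub> frag_of (uea_class ie_algebra p \<otimes>\<^bsub>uea ie_algebra\<^esub> u, z))
          = free_act V \<rho> p (g (verma.Rels lam #>\<^bsub>verma.Pairs\<^esub> frag_of (u, z)))"
        if u: "u \<in> carrier (uea ie_algebra)" for u z
        unfolding g_of[OF u] g_of[OF U.m_closed[OF ie.uea_class_closed[OF all] u]]
        by (rule b_mult[OF u])
    qed
    then show ?thesis
      by (simp add: verma_uea_act_def verma_tensor_def)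
  qed
  show ?thesis
  proof (rule that)
    show "g \<in> rep_hom ie_algebra (verma lam) (verma_act lam) V \<rho>"
      using g hom_in_carrier[OF g]
      by (auto simp: rep_hom_def verma_def verma_act_def equivariant hom_def free_act_scalar free_act_letter)
    have "g (verma.Rels lam #>\<^bsub>verma.Pairs\<^esub> frag_of (uea_class ie_algebra 1, 1)) = v"
      unfolding g_of[OF ie.uea_class_closed[OF all]]
      using v by (simp add: b_def act_class free_act_one scal_one)
    moreover have "verma.Rels lam #>\<^bsub>verma.Pairs\<^esub> frag_of (uea_class ie_algebra 1, 1) \<in> carrier (verma lam)"
    proof -
      have "carrier (verma lam) = carrier (verma_tensor lam)"
        by (simp add: verma_def)
      moreover have "frag_of (uea_class ie_algebra 1, 1) \<in> carrier verma.Pairs"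
        using ie.uea_class_closed[OF all] by simp
      ultimately show ?thesis
        unfolding verma_tensor_def verma.carrier_tensor by blast
    qed
    ultimately show "v \<in> g ` carrier (verma lam)"
      by (rule image_eqI[OF sym])
  qed
qed

section \<open>Irreducible modules\<close>

text \<open>Zero and negatives in the image come from the scalars \<open>0\<close> and \<open>-1\<close>, and the module axioms are inherited
from \<open>W\<close>. In this form the lemma applies to a Verma module once its carrier is closed under the operations.\<close>

lemma subrep_image:
  assumes "lie_rep L W \<sigma>" and f: "f \<in> rep_hom L V \<rho> W \<sigma>" and ne: "carrier V \<noteq> {}"
    and add: "\<And>v w. \<lbrakk>v \<in> carrier V; w \<in> carrier V\<rbrakk> \<Longrightarrow> v \<oplus>\<^bsub>V\<^esub> w \<in> carrier V"
    and scale: "\<And>c v. v \<in> carrier V \<Longrightarrow> c \<odot>\<^bsub>V\<^esub> v \<in> carrier V"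
    and act: "\<And>x v. \<lbrakk>x \<in> carrier L; v \<in> carrier V\<rbrakk> \<Longrightarrow> \<rho> x v \<in> carrier V"
  shows "subrep L W \<sigma> (f ` carrier V)"
proof -
  interpret lie_rep L W \<sigma> by fact
  have f_closed: "f v \<in> carrier W" and f_scale: "c \<odot>\<^bsub>W\<^esub> f v = f (c \<odot>\<^bsub>V\<^esub> v)"
    if "v \<in> carrier V" for v c
    using f that by (auto simp: rep_hom_def)
  have f_add: "f v \<oplus>\<^bsub>W\<^esub> f w = f (v \<oplus>\<^bsub>V\<^esub> w)" if "v \<in> carrier V" "w \<in> carrier V" for v w
    using f that by (auto simp: rep_hom_def)
  have f_act: "\<sigma> x (f v) = f (\<rho> x v)" if "x \<in> carrier L" "v \<in> carrier V" for x v
    using f that by (auto simp: rep_hom_def)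
  have "submodule (f ` carrier V) complex_ring W"
  proof (rule submoduleI)
    obtain v where v: "v \<in> carrier V" using ne by blast
    have "\<zero>\<^bsub>W\<^esub> = f (0 \<odot>\<^bsub>V\<^esub> v)"
      using f_scale[OF v, of 0] scal_zero f_closed[OF v] by simp
    then show "\<zero>\<^bsub>W\<^esub> \<in> f ` carrier V" using scale[OF v] by blast
    show "\<ominus>\<^bsub>W\<^esub> w \<in> f ` carrier V" if w: "w \<in> f ` carrier V" for w
    proof -
      obtain v where v: "v \<in> carrier V" "w = f v" using w by blast
      have "(- 1) \<odot>\<^bsub>W\<^esub> w \<oplus>\<^bsub>W\<^esub> w = \<zero>\<^bsub>W\<^esub>"
        using scal_add_left[of w "- 1" 1] f_closed v by (simp add: scal_one scal_zero)
      then have "\<ominus>\<^bsub>W\<^esub> w = (- 1) \<odot>\<^bsub>W\<^esub> w"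
        using f_closed v by (intro minus_equality) auto
      then show ?thesis using v f_scale scale by auto
    qed
  qed (auto simp: f_closed f_add f_scale add scale)
  then show ?thesis
    by (auto simp: subrep_def f_act act)
qed

theorem lemma3p2:
  fixes V :: "(complex, 'v) module" and \<rho> :: "ie \<Rightarrow> 'v \<Rightarrow> 'v"
  assumes "category_O V \<rho>"
    and "irreducible_rep ie_algebra V \<rho>"
  shows "\<exists>lam. \<exists>f \<in> rep_hom ie_algebra (verma lam) (verma_act lam) V \<rho>.
           f ` carrier (verma lam) = carrier V"
proof -
  have rep: "lie_rep ie_algebra V \<rho>" and nz: "carrier V \<noteq> {\<zero>\<^bsub>V\<^esub>}"
    and irr: "\<And>U. subrep ie_algebra V \<rho> U \<Longrightarrow> U = {\<zero>\<^bsub>V\<^esub>} \<or> U = carrier V"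
    using assms(2) by (auto simp: irreducible_rep_def)
  obtain lam v where v: "lowest_weight_vector V \<rho> lam v" "v \<noteq> \<zero>\<^bsub>V\<^esub>"
    by (rule category_O_lowest_weight_vector[OF assms(1) nz])
  obtain f where f: "f \<in> rep_hom ie_algebra (verma lam) (verma_act lam) V \<rho>"
    and vf: "v \<in> f ` carrier (verma lam)"
    by (rule verma_universal[OF rep v(1)])
  have "subrep ie_algebra V \<rho> (f ` carrier (verma lam))"
    using vf by (intro subrep_image[OF rep f] verma_closed) auto
  then have "f ` carrier (verma lam) = carrier V"
    using irr v(2) vf by blast
  then show ?thesis using f by blast
qed

end
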